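(* Fix $\hat r>0$ and let $\mathbb G$ be the set of $C^2$ simple closed curves $\gamma$ in $\mathbb R^2$ that are tangentially graph-like for radius $r=\hat r$. Suppose that for $r=\hat r$, for all $s\in[0,L]$ and for each $\gamma\in\mathbb G$ (of length $L$) we know the first-, second- and third-order partial derivatives of $g_\gamma(s,r)$. Then the set of reconstructible $\gamma\in\mathbb G$ is $C^1$ dense in $\mathbb G$, where reconstructibility is modulo reparametrization, translation and rotation.
   Context: For a simple closed curve of length $L$ bounding the compact region $\Omega$, $\gamma:[0,L]\to\partial\Omega$ is the counterclockwise arclength parameterization, $D(p,r)$ is the closed disk of radius $r$ about $p$, and $g_\gamma(s,r)=\operatorname{Area}(\Omega\cap D(\gamma(s),r))$. $\partial\Omega$ is tangentially graph-like (TGL) at $p\in\partial\Omega$ for radius $r$ if $\partial\Omega$ is continuously differentiable and there is a Cartesian coordinate system with origin $p$ in which $\partial\Omega\cap D(p,r)$ is the graph of a function $f$ with $f(0)=0$, $f'(0)=0$; it is TGL for radius $r$ if this holds at every $p\in\partial\Omega$. A curve $\gamma\in\mathbb G$ is reconstructible if it is determined within $\mathbb G$ by the data consisting of the first-, second- and third-order partial derivatives (in $s$ and $r$, where they exist) of $g_\gamma$ at the points $(s,\hat r)$, $s\in[0,L]$: any $\tilde\gamma\in\mathbb G$ with the same data equals $\gamma$ up to reparametrization, translation and rotation. $C^1$ dense means that for every $\gamma\in\mathbb G$ there are reconstructible curves in $\mathbb G$ arbitrarily $C^1$-close to $\gamma$ (as parametrized curves, on a common parameter domain). *)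

theory Defs
  imports "HOL-Complex_Analysis.Complex_Analysis"
begin

(* The plane is the type complex; translations and rotations are z \<mapsto> a * z + b with norm a = 1.
   A closed curve is a pair (L, \<gamma>): \<gamma> is defined on all of the reals and is L-periodic, so that
   the closed curve is C^k across the base point exactly if \<gamma> is C^k. *)

type_synonym closed_curve = "real \<times> (real \<Rightarrow> complex)"

definition unit_param :: "closed_curve \<Rightarrow> real \<Rightarrow> complex" where
  "unit_param = (\<lambda>(L, \<gamma>) t. \<gamma> (L * t))"

definition boundary :: "closed_curve \<Rightarrow> complex set" where
  "boundary = (\<lambda>(L, \<gamma>). \<gamma> ` {0..L})"

definition region :: "closed_curve \<Rightarrow> complex set" where
  "region c = boundary c \<union> inside (boundary c)"

definition C2_simple_closed_arclength :: "closed_curve \<Rightarrow> bool" where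
  "C2_simple_closed_arclength = (\<lambda>(L, \<gamma>).
     L > 0 \<and> (\<forall>s. \<gamma> (s + L) = \<gamma> s) \<and>
     \<gamma> C1_differentiable_on UNIV \<and>
     (\<lambda>s. vector_derivative \<gamma> (at s)) C1_differentiable_on UNIV \<and>
     (\<forall>s. norm (vector_derivative \<gamma> (at s)) = 1) \<and>
     simple_path (unit_param (L, \<gamma>)))"

definition counterclockwise :: "closed_curve \<Rightarrow> bool" where
  "counterclockwise c \<longleftrightarrow> (\<forall>z \<in> inside (boundary c). winding_number (unit_param c) z = 1)"

(* (u, v) is the orthonormal frame of the coordinate system and X is the domain of the function f,
   of which 0 is an interior point so that the derivative at 0 is the ordinary one. *)
definition TGL_at :: "closed_curve \<Rightarrow> complex \<Rightarrow> real \<Rightarrow> bool" where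
  "TGL_at c p r \<longleftrightarrow> snd c C1_differentiable_on UNIV \<and>
     (\<exists>u v X f. norm u = 1 \<and> norm v = 1 \<and> u \<bullet> v = 0 \<and>
        0 \<in> interior X \<and> f 0 = 0 \<and> (f has_real_derivative 0) (at 0) \<and>
        boundary c \<inter> cball p r = (\<lambda>x. p + x *\<^sub>R u + f x *\<^sub>R v) ` X)"

definition TGL :: "closed_curve \<Rightarrow> real \<Rightarrow> bool" where
  "TGL c r \<longleftrightarrow> (\<forall>p \<in> boundary c. TGL_at c p r)"

definition TGL_curves :: "real \<Rightarrow> closed_curve set" where
  "TGL_curves r = {c. C2_simple_closed_arclength c \<and> counterclockwise c \<and> TGL c r}"

definition area_fun :: "closed_curve \<Rightarrow> real \<Rightarrow> real \<Rightarrow> real" where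
  "area_fun c s r = measure lebesgue (region c \<inter> cball (snd c s) r)"

datatype variable = Var_s | Var_r

(* "has_partial g [v\<^sub>1, \<dots>, v\<^sub>k] s r d": the iterated partial derivative of g with respect to
   v\<^sub>k, then \<dots>, then v\<^sub>1 exists at (s, r) and equals d.  All orders of differentiation are kept
   apart, and the inner derivative is only required near the point on the line of the outer one. *)
primrec has_partial ::
  "(real \<Rightarrow> real \<Rightarrow> real) \<Rightarrow> variable list \<Rightarrow> real \<Rightarrow> real \<Rightarrow> real \<Rightarrow> bool" where
  "has_partial g [] s r d \<longleftrightarrow> g s r = d"
| "has_partial g (v # vs) s r d \<longleftrightarrow>
     (case v of
        Var_s \<Rightarrow> \<exists>h. (\<forall>\<^sub>F x in nhds s. has_partial g vs x r (h x)) \<and>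
                    (h has_real_derivative d) (at s)
      | Var_r \<Rightarrow> \<exists>h. (\<forall>\<^sub>F x in nhds r. has_partial g vs s x (h x)) \<and>
                    (h has_real_derivative d) (at r))"

(* The derivatives may fail to exist; the data record where they exist and their values there. *)
definition same_data :: "real \<Rightarrow> closed_curve \<Rightarrow> closed_curve \<Rightarrow> bool" where
  "same_data r c c' \<longleftrightarrow> fst c = fst c' \<and>
     (\<forall>vs. length vs \<in> {1, 2, 3} \<longrightarrow>
       (\<forall>s \<in> {0..fst c}. \<forall>d.
          has_partial (area_fun c) vs s r d \<longleftrightarrow> has_partial (area_fun c') vs s r d))"

definition equal_mod_reparam_rigid :: "closed_curve \<Rightarrow> closed_curve \<Rightarrow> bool" where
  "equal_mod_reparam_rigid c c' \<longleftrightarrow>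
     (\<exists>a b \<phi> \<psi>. norm a = 1 \<and> homeomorphism UNIV UNIV \<phi> \<psi> \<and>
        (\<forall>s. snd c' s = a * snd c (\<phi> s) + b))"

definition reconstructible :: "real \<Rightarrow> closed_curve \<Rightarrow> bool" where
  "reconstructible r c \<longleftrightarrow> c \<in> TGL_curves r \<and>
     (\<forall>c' \<in> TGL_curves r. same_data r c c' \<longrightarrow> equal_mod_reparam_rigid c c')"

(* Curves of different lengths are compared on the common parameter domain {0..1}. *)
definition C1_close :: "real \<Rightarrow> closed_curve \<Rightarrow> closed_curve \<Rightarrow> bool" where
  "C1_close \<epsilon> c c' \<longleftrightarrow> (\<forall>t \<in> {0..1}.
     norm (unit_param c t - unit_param c' t) < \<epsilon> \<and>
     norm (vector_derivative (unit_param c) (at t) - vector_derivative (unit_param c') (at t)) < \<epsilon>)"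

definition C1_dense_in :: "closed_curve set \<Rightarrow> closed_curve set \<Rightarrow> bool" where
  "C1_dense_in A G \<longleftrightarrow> A \<subseteq> G \<and> (\<forall>c \<in> G. \<forall>\<epsilon>>0. \<exists>c' \<in> A. C1_close \<epsilon> c c')"

end

theory Submission
  imports Defs
begin

text \<open>
  Every curve in the class is reconstructible. Fix a curve with unit tangent \<open>T\<close>. The graph condition says
  that a chord \<open>\<gamma> t - \<gamma> s\<close> of length at most \<open>r\<close> is never orthogonal to \<open>T s\<close>, so the circle of radius \<open>r\<close> about
  \<open>\<gamma> s\<close> meets the curve transversally in exactly two points \<open>\<gamma> t1\<close> and \<open>\<gamma> t2\<close>. Let \<open>a1\<close>, \<open>a2\<close> be the unit
  vectors towards them, in the frame of \<open>T s\<close>; then \<open>Re a1 > 0 > Re a2\<close>. The \<open>r\<close>-derivative of the area is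
  \<open>r\<close> times the angle from \<open>a1\<close> to \<open>a2\<close> and its \<open>s\<close>-derivative is \<open>r * Im (a2 - a1)\<close>, which together determine
  \<open>a1\<close> and \<open>a2\<close>. The second \<open>r\<close>-derivative determines \<open>m2 - m1\<close>, where \<open>mi\<close> is the tangent of the angle between
  the curve and the radius at the crossing. Finally, \<open>Im (ai' * cnj ai) = (mi * Re ai + Im ai) / r - \<kappa>\<close>
  for \<open>i = 1, 2\<close>, and since \<open>Re a1\<close> and \<open>Re a2\<close> differ these equations determine the curvature \<open>\<kappa>\<close> at \<open>s\<close>,
  hence the curve up to a rigid motion.
\<close>

section \<open>Lebesgue measure on the complex plane\<close>

text \<open>Near a crossing the region inside the disk has corners, so its area is awkward to
  differentiate as a planar figure. Off a null set the indicator of the inside is the winding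
  number, hence a Cauchy integral along the curve. Integrating it over the disk and exchanging
  integrals turns the area into a curve integral of \<open>disk_kernel\<close>. This kernel is not
  smooth across the circle, but it is Lipschitz in position and in radius, so dominated convergence
  yields both first derivatives. The crossing parameters come from a choice, so their continuity has
  to be recovered from the sign of distance minus radius before the implicit equation can be
  differentiated. For the curvature the count matters: at fixed s the unknowns are m1, m2 and
  \<kappa>. One equation is the known difference of the slopes; the other two arise because a1 and
  a2 are known for all s in the interval, so their derivatives in s are known too.\<close>

lemma lborel_complex_eq_distr:
  "distr (lborel \<Otimes>\<^sub>M lborel) borel (\<lambda>(x, y). Complex x y) = lborel"
proof (rule lborel_eqI[symmetric])
  have meas: "(\<lambda>(x, y). Complex x y) \<in> borel_measurable (lborel \<Otimes>\<^sub>M lborel)"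
    by (simp add: lborel_prod case_prod_beta Complex_eq borel_measurable_continuous_onI continuous_intros)
  fix l u :: complex
  assume "\<And>b. b \<in> Basis \<Longrightarrow> l \<bullet> b \<le> u \<bullet> b"
  then have le: "Re l \<le> Re u" "Im l \<le> Im u"
    by (force simp: Basis_complex_def)+
  have "(\<lambda>(x, y). Complex x y) -` box l u \<inter> space (lborel \<Otimes>\<^sub>M lborel) =
      {Re l<..<Re u} \<times> {Im l<..<Im u}"
    by (auto simp: box_def Basis_complex_def space_pair_measure)
  then have "emeasure (distr (lborel \<Otimes>\<^sub>M lborel) borel (\<lambda>(x, y). Complex x y)) (box l u)
      = ennreal (Re u - Re l) * ennreal (Im u - Im l)"
    using le by (simp add: emeasure_distr[OF meas] lborel.emeasure_pair_measure_Times)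
  then show "emeasure (distr (lborel \<Otimes>\<^sub>M lborel) borel (\<lambda>(x, y). Complex x y)) (box l u)
      = (\<Prod>b\<in>Basis. (u - l) \<bullet> b)"
    using le by (simp add: Basis_complex_def ennreal_mult)
qed simp

lemma nn_integral_lborel_complex:
  fixes f :: "complex \<Rightarrow> ennreal"
  assumes [measurable]: "f \<in> borel_measurable borel"
  shows "integral\<^sup>N lborel f = (\<integral>\<^sup>+x. \<integral>\<^sup>+y. f (Complex x y) \<partial>lborel \<partial>lborel)"
proof -
  have meas[measurable]: "(\<lambda>(x, y). Complex x y) \<in> borel_measurable (lborel \<Otimes>\<^sub>M lborel)"
    by (simp add: lborel_prod case_prod_beta Complex_eq borel_measurable_continuous_onI continuous_intros)
  have "integral\<^sup>N lborel f = (\<integral>\<^sup>+p. f (case p of (x, y) \<Rightarrow> Complex x y) \<partial>(lborel \<Otimes>\<^sub>M lborel))"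
    by (subst lborel_complex_eq_distr[symmetric]) (simp add: nn_integral_distr)
  also have "\<dots> = (\<integral>\<^sup>+x. \<integral>\<^sup>+y. f (Complex x y) \<partial>lborel \<partial>lborel)"
    by (subst lborel.nn_integral_fst[symmetric]) auto
  finally show ?thesis .
qed

lemma Complex_measurable[measurable (raw)]:
  assumes "f \<in> borel_measurable M" "g \<in> borel_measurable M"
  shows "(\<lambda>x. Complex (f x) (g x)) \<in> borel_measurable M"
  using assms by (simp add: Complex_eq)

text \<open>The rotation is split into two one-dimensional substitutions. For fixed x the new
  imaginary part v replaces y, with factor \<open>1/c\<close>; after exchanging the integrals the
  new real part u replaces x, with factor \<open>c\<close>. The factors cancel. The first
  substitution divides by the real part of a, whence the assumption on it.\<close>

lemma nn_integral_rotate_aux: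
  fixes f :: "complex \<Rightarrow> ennreal"
  assumes [measurable]: "f \<in> borel_measurable borel" and a: "norm a = 1" "Re a \<noteq> 0"
  shows "(\<integral>\<^sup>+z. f (a * z) \<partial>lborel) = integral\<^sup>N lborel f"
proof -
  define c where "c = Re a"
  define s where "s = Im a"
  have cs: "c * c + s * s = 1" "c \<noteq> 0"
    using a by (auto simp: c_def s_def cmod_def power2_eq_square)
  have "(\<integral>\<^sup>+z. f (a * z) \<partial>lborel)
      = (\<integral>\<^sup>+x. \<integral>\<^sup>+y. f (a * Complex x y) \<partial>lborel \<partial>lborel)"
    by (rule nn_integral_lborel_complex) measurable
  also have "\<dots> = (\<integral>\<^sup>+x. \<integral>\<^sup>+y. f (Complex (c * x - s * y) (s * x + c * y)) \<partial>lborel \<partial>lborel)"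
    by (simp add: c_def s_def times_complex.ctr algebra_simps)
  also have "\<dots> = (\<integral>\<^sup>+x. ennreal \<bar>1/c\<bar> * (\<integral>\<^sup>+v. f (Complex (c * x - s * (- s * x / c + 1/c * v)) v) \<partial>lborel) \<partial>lborel)"
  proof (intro nn_integral_cong)
    fix x
    show "(\<integral>\<^sup>+y. f (Complex (c * x - s * y) (s * x + c * y)) \<partial>lborel)
      = ennreal \<bar>1/c\<bar> * (\<integral>\<^sup>+v. f (Complex (c * x - s * (- s * x / c + 1/c * v)) v) \<partial>lborel)"
      using cs by (subst nn_integral_real_affine[where c="1/c" and t="- s * x / c"])
        (auto simp: field_simps)
  qed
  also have "\<dots> = ennreal \<bar>1/c\<bar> * (\<integral>\<^sup>+v. \<integral>\<^sup>+x. f (Complex (c * x - s * (- s * x / c + 1/c * v)) v) \<partial>lborel \<partial>lborel)"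
    by (subst nn_integral_cmult, measurable) (subst lborel_pair.Fubini', measurable)
  also have "\<dots> = ennreal \<bar>1/c\<bar> * (\<integral>\<^sup>+v. ennreal \<bar>c\<bar> * (\<integral>\<^sup>+u. f (Complex u v) \<partial>lborel) \<partial>lborel)"
  proof -
    have "(\<integral>\<^sup>+x. f (Complex (c * x - s * (- s * x / c + 1/c * v)) v) \<partial>lborel)
       = ennreal \<bar>c\<bar> * (\<integral>\<^sup>+u. f (Complex u v) \<partial>lborel)" for v
    proof -
      have "c * (s * v + c * u) - s * (- s * (s * v + c * u) / c + 1/c * v) = u" for u
      proof -
        have "c * (c * (s * v + c * u) - s * (- s * (s * v + c * u) / c + 1/c * v))
          = (c * c + s * s) * (s * v + c * u) - s * v"
          using cs(2) by (simp add: field_simps)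
        also have "\<dots> = c * u" by (simp add: cs)
        finally show ?thesis using cs(2) by simp
      qed
      then show ?thesis
        using cs by (subst nn_integral_real_affine[where c=c and t="s * v"]) simp_all
    qed
    then show ?thesis by simp
  qed
  also have "\<dots> = (ennreal \<bar>1/c\<bar> * ennreal \<bar>c\<bar>) * (\<integral>\<^sup>+v. \<integral>\<^sup>+u. f (Complex u v) \<partial>lborel \<partial>lborel)"
    by (subst nn_integral_cmult) (measurable, simp add: mult.assoc)
  also have "ennreal \<bar>1/c\<bar> * ennreal \<bar>c\<bar> = 1"
    using cs by (simp add: ennreal_mult[symmetric])
  also have "(\<integral>\<^sup>+v. \<integral>\<^sup>+u. f (Complex u v) \<partial>lborel \<partial>lborel) = integral\<^sup>N lborel f"
    by (subst nn_integral_lborel_complex) (measurable, subst lborel_pair.Fubini', measurable)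
  finally show ?thesis by simp
qed

text \<open>The exceptional rotations, those with real part 0, are performed as two rotations by a
  square root b of a. If b had real part 0 as well, then \<open>b * b\<close> would be real, hence
  0, against \<open>norm b = 1\<close>.\<close>

lemma distr_lborel_rotate:
  fixes a :: complex
  assumes "norm a = 1"
  shows "distr lborel borel ((*) a) = lborel"
proof (rule measure_eqI)
  fix A :: "complex set" assume "A \<in> sets (distr lborel borel ((*) a))"
  then have A[measurable]: "A \<in> sets borel" by simp
  define b where "b = csqrt a"
  have b: "b * b = a" "norm b = 1"
    using assms by (auto simp: b_def norm_csqrt simp flip: power2_eq_square)
  have *: "emeasure (distr lborel borel ((*) a)) A = (\<integral>\<^sup>+z. indicator A (a * z) \<partial>lborel)"
    by (simp add: nn_integral_distr flip: nn_integral_indicator)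
  have "(\<integral>\<^sup>+z. indicator A (a * z) \<partial>lborel) = (\<integral>\<^sup>+z. indicator A z \<partial>lborel)"
  proof (cases "Re a = 0")
    case True
    have "Re b \<noteq> 0"
    proof
      assume "Re b = 0"
      then have "Re (b*b) = - (Im b)\<^sup>2" by (simp add: power2_eq_square)
      then have "Im b = 0" using b True by simp
      with \<open>Re b = 0\<close> show False using b by (simp add: cmod_def)
    qed
    then have "(\<integral>\<^sup>+z. indicator A (b * (b * z)) \<partial>lborel) = (\<integral>\<^sup>+z. indicator A z \<partial>lborel)"
      using nn_integral_rotate_aux[of "\<lambda>z. indicator A (b * z)" b]
        nn_integral_rotate_aux[of "indicator A" b] b by simp
    then show ?thesis using b by (simp add: mult.assoc[symmetric])
  qed (use assms nn_integral_rotate_aux[of "indicator A"] in simp)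
  then show "emeasure (distr lborel borel ((*) a)) A = emeasure lborel A"
    using * by simp
qed simp

section \<open>Local integrability of the inverse modulus in the plane\<close>

lemma nn_integral_inverse_sqrt_finite:
  fixes R :: real
  shows "(\<integral>\<^sup>+x. indicator {-R..R} x * ennreal (\<bar>x\<bar> powr (-1/2)) \<partial>lborel) < \<infinity>"
proof (cases "R \<ge> 0")
  case True
  have *: "(\<integral>\<^sup>+x. ennreal (\<bar>x\<bar> powr (-1/2)) * indicator {0..R} x \<partial>lborel) < \<infinity>"
  proof -
    have "((\<lambda>x. x powr (-1/2)) has_integral (R powr (-1/2 + 1) / (-1/2 + 1))) {0..R}"
      using True by (intro has_integral_powr_from_0) auto
    then have "((\<lambda>x. \<bar>x\<bar> powr (-1/2)) has_integral (R powr (-1/2 + 1) / (-1/2 + 1))) {0..R}"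
      by (rule has_integral_eq[rotated]) auto
    from nn_integral_has_integral_lebesgue'[OF _ this] show ?thesis by simp
  qed
  have "(\<integral>\<^sup>+x. indicator {-R..R} x * ennreal (\<bar>x\<bar> powr (-1/2)) \<partial>lborel)
     \<le> (\<integral>\<^sup>+x. ennreal (\<bar>x\<bar> powr (-1/2)) * indicator {0..R} x
        + ennreal (\<bar>- x\<bar> powr (-1/2)) * indicator {0..R} (- x) \<partial>lborel)"
    by (intro nn_integral_mono) (auto simp: indicator_def)
  also have "\<dots> = (\<integral>\<^sup>+x. ennreal (\<bar>x\<bar> powr (-1/2)) * indicator {0..R} x \<partial>lborel)
     + (\<integral>\<^sup>+x. ennreal (\<bar>- x\<bar> powr (-1/2)) * indicator {0..R} (- x) \<partial>lborel)"
    by (intro nn_integral_add) measurable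
  also have "(\<integral>\<^sup>+x. ennreal (\<bar>- x\<bar> powr (-1/2)) * indicator {0..R} (- x) \<partial>lborel)
      = (\<integral>\<^sup>+x. ennreal (\<bar>x\<bar> powr (-1/2)) * indicator {0..R} x \<partial>lborel)"
    by (subst (2) nn_integral_real_affine[where c="-1" and t=0]) auto
  finally show ?thesis using * ennreal_add_less_top order_le_less_trans by fastforce
qed simp

text \<open>From \<bar>x\<bar> \<bar>y\<bar> \<le> x^2 + y^2 the inverse modulus is at most the
  product of the inverse square roots of \<bar>x\<bar> and \<bar>y\<bar>. The double integral is
  thereby bounded by a product of two finite one-dimensional integrals.\<close>

lemma integrable_lborel_inverse_cmod:
  "set_integrable lborel (cball 0 R) (\<lambda>z::complex. inverse (norm z))"
proof -
  define k where "k x = indicator {-R..R} x * ennreal (\<bar>x\<bar> powr (-1/2))" for x :: real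
  have k[measurable]: "k \<in> borel_measurable borel" unfolding k_def by measurable
  have [measurable]: "cball 0 R \<in> sets (borel :: complex measure)" by simp
  have [measurable]: "(\<lambda>z::complex. inverse (norm z)) \<in> borel_measurable borel"
    by (intro borel_measurable_inverse borel_measurable_norm)
  \<comment> \<open>A power with base 0 has value 0 under \<open>powr\<close>, so the product bound
    breaks down on the coordinate axes; they are discarded as null sets.\<close>
  have nz: "AE x in lborel. x \<noteq> (0::real)" by (rule AE_lborel_singleton)
  have le: "ennreal (indicator (cball 0 R) (Complex x y) * inverse (norm (Complex x y))) \<le> k x * k y"
    if "x \<noteq> 0" "y \<noteq> 0" for x y
  proof (cases "norm (Complex x y) \<le> R")
    case True
    have xy: "\<bar>x\<bar> \<le> R" "\<bar>y\<bar> \<le> R"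
      using True abs_Re_le_cmod[of "Complex x y"] abs_Im_le_cmod[of "Complex x y"] by auto
    have "0 \<le> (\<bar>x\<bar> - \<bar>y\<bar>)\<^sup>2" by simp
    also have "\<dots> = x\<^sup>2 + y\<^sup>2 - 2 * (\<bar>x\<bar> * \<bar>y\<bar>)" by (simp add: power2_diff)
    finally have "\<bar>x\<bar> * \<bar>y\<bar> \<le> x\<^sup>2 + y\<^sup>2"
      using mult_nonneg_nonneg[of "\<bar>x\<bar>" "\<bar>y\<bar>"] by linarith
    then have "sqrt (\<bar>x\<bar> * \<bar>y\<bar>) \<le> norm (Complex x y)" by (simp add: cmod_def)
    then have "inverse (norm (Complex x y)) \<le> inverse (sqrt (\<bar>x\<bar> * \<bar>y\<bar>))"
      using that by (intro le_imp_inverse_le) auto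
    also have "\<dots> = \<bar>x\<bar> powr (-1/2) * \<bar>y\<bar> powr (-1/2)"
      using that by (simp add: real_sqrt_mult powr_minus powr_half_sqrt)
    finally show ?thesis using xy True
      by (simp add: k_def indicator_def ennreal_mult'[symmetric] ennreal_leI abs_le_iff)
  qed (simp add: indicator_def)
  have "(\<integral>\<^sup>+z. ennreal (indicator (cball 0 R) z * inverse (norm (z::complex))) \<partial>lborel)
     = (\<integral>\<^sup>+x. \<integral>\<^sup>+y. ennreal (indicator (cball 0 R) (Complex x y) * inverse (norm (Complex x y))) \<partial>lborel \<partial>lborel)"
    by (rule nn_integral_lborel_complex) measurable
  also have "\<dots> \<le> (\<integral>\<^sup>+x. \<integral>\<^sup>+y. k x * k y \<partial>lborel \<partial>lborel)"
  proof (rule nn_integral_mono_AE)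
    show "AE x in lborel. (\<integral>\<^sup>+y. ennreal (indicator (cball 0 R) (Complex x y) * inverse (norm (Complex x y))) \<partial>lborel)
        \<le> (\<integral>\<^sup>+y. k x * k y \<partial>lborel)"
      using nz
    proof eventually_elim
      case (elim x)
      show ?case
        by (rule nn_integral_mono_AE) (use nz in eventually_elim, use elim le in blast)
    qed
  qed
  also have "\<dots> = (\<integral>\<^sup>+x. k x \<partial>lborel) * (\<integral>\<^sup>+y. k y \<partial>lborel)"
    by (simp add: nn_integral_cmult nn_integral_multc)
  also have "\<dots> < \<infinity>"
    using nn_integral_inverse_sqrt_finite[of R] by (simp add: k_def[abs_def] ennreal_mult_less_top)
  finally have fin: "(\<integral>\<^sup>+z. ennreal (indicator (cball 0 R) z * inverse (norm (z::complex))) \<partial>lborel) < \<infinity>" .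
  show ?thesis
    unfolding set_integrable_def
  proof (rule integrableI_bounded)
    show "(\<integral>\<^sup>+z. ennreal (norm (indicator (cball 0 R) z *\<^sub>R inverse (norm (z::complex)))) \<partial>lborel) < \<infinity>"
      using fin by (simp add: abs_mult)
    show "(\<lambda>z::complex. indicator (cball 0 R) z *\<^sub>R inverse (norm z)) \<in> borel_measurable lborel"
      by measurable
  qed
qed

section \<open>The Cauchy kernel integrated over a disk\<close>

text \<open>Up to the factor \<pi> this is the Cauchy transform of the disk, that is, the integral
  of \<open>1 / (w - z)\<close> over z in the disk of radius \<rho> about 0. The two branches agree
  on the circle.\<close>

definition disk_kernel :: "real \<Rightarrow> complex \<Rightarrow> complex" where
  "disk_kernel \<rho> w = (if norm w \<le> \<rho> then cnj w else of_real (\<rho>\<^sup>2) / w)"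

lemma has_integral_mean_value_circle:
  assumes "F holomorphic_on cball 0 1"
  shows "((\<lambda>t. F (cis t)) has_integral 2 * of_real pi * F 0) {0..2*pi}"
proof -
  have "((\<lambda>u. F u / (u - 0)) has_contour_integral (2 * of_real pi * \<i> * F 0)) (circlepath 0 1)"
    using assms by (intro Cauchy_integral_circlepath_simple) auto
  then have "((\<lambda>t. F (0 + complex_of_real 1 * cis t) / (0 + complex_of_real 1 * cis t - 0) * complex_of_real 1 * \<i> * cis t)
      has_integral 2 * of_real pi * \<i> * F 0) {0..2*pi}"
    unfolding circlepath_def by (subst (asm) has_contour_integral_part_circlepath_iff) auto
  then have "((\<lambda>t. \<i> * F (cis t)) has_integral \<i> * (2 * of_real pi * F 0)) {0..2*pi}"
    by (simp add: mult_ac)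
  then have "((\<lambda>t. -\<i> * (\<i> * F (cis t))) has_integral -\<i> * (\<i> * (2 * of_real pi * F 0))) {0..2*pi}"
    by (rule has_integral_mult_right)
  then show ?thesis by simp
qed

text \<open>Both cases are the mean value property in the variable u on the unit circle. If z is the
  smaller point, the integrand is holomorphic in the unit disk with value \<open>1 / w\<close> at 0.
  If w is the smaller one, the integrand is conjugated: since the conjugate of u is 1/u on the
  circle, it becomes \<open>u / (cnj w * u - cnj z)\<close>, holomorphic in the disk and 0 at the
  centre.\<close>

lemma has_integral_circle_Cauchy_kernel:
  assumes "norm z \<noteq> norm w"
  shows "((\<lambda>t. 1 / (w - cis t * z)) has_integral (if norm z < norm w then 2 * of_real pi / w else 0)) {0..2*pi}"
proof (cases "norm z < norm w")
  case True
  have "(\<lambda>u. 1 / (w - u * z)) holomorphic_on cball 0 1"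
  proof (intro holomorphic_intros)
    fix u :: complex assume "u \<in> cball 0 1"
    then have "norm (u * z) \<le> norm z" by (simp add: norm_mult mult_left_le_one_le)
    then show "w - u * z \<noteq> 0" using True by auto
  qed
  from has_integral_mean_value_circle[OF this] True show ?thesis by simp
next
  case False
  with assms have less: "norm w < norm z" by simp
  have "(\<lambda>u. u / (cnj w * u - cnj z)) holomorphic_on cball 0 1"
  proof (intro holomorphic_intros)
    fix u :: complex assume "u \<in> cball 0 1"
    then have "norm (cnj w * u) \<le> norm w" by (simp add: norm_mult mult_right_le_one_le)
    then show "cnj w * u - cnj z \<noteq> 0" using less by auto
  qed
  from has_integral_linear[OF has_integral_mean_value_circle[OF this] bounded_linear_cnj]
  have "((\<lambda>t. cnj (cis t / (cnj w * cis t - cnj z))) has_integral cnj 0) {0..2*pi}"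
    by (simp add: o_def)
  moreover have "cnj (cis t / (cnj w * cis t - cnj z)) = 1 / (w - cis t * z)" for t
  proof -
    have c: "cnj (cis t) * cis t = 1" by (simp add: cis_cnj flip: cis_inverse)
    have "cnj (cis t / (cnj w * cis t - cnj z)) = cnj (cis t) / (w * cnj (cis t) - z)" by simp
    also have "w * cnj (cis t) - z = cnj (cis t) * (w - cis t * z)"
      using c by (simp add: algebra_simps)
    finally show ?thesis by simp
  qed
  ultimately show ?thesis using False by simp
qed

lemma lborel_complex_reflect:
  "distr lborel borel (\<lambda>z. w - z) = (lborel :: complex measure)"
  using lborel_affine[of "-1" w] by (simp add: density_1)

text \<open>The reflection z \<mapsto> w - z carries the disk into the ball of radius R about 0, so
  the bound depends on w only through R. This uniformity along a bounded curve is what Fubini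
  needs.\<close>

lemma nn_integral_disk_Cauchy_kernel_le:
  fixes w :: complex
  assumes "norm (w - p) + \<rho> \<le> R"
  shows "(\<integral>\<^sup>+z. ennreal (norm (indicator (cball p \<rho>) z *\<^sub>R (1 / (w - z)))) \<partial>lborel)
    \<le> (\<integral>\<^sup>+z. ennreal (indicator (cball 0 R) z * inverse (norm (z::complex))) \<partial>lborel)"
proof -
  have [measurable]: "cball 0 R \<in> sets (borel :: complex measure)" by simp
  have [measurable]: "(\<lambda>z::complex. inverse (norm z)) \<in> borel_measurable borel"
    by (intro borel_measurable_inverse borel_measurable_norm)
  have "(\<integral>\<^sup>+z. ennreal (norm (indicator (cball p \<rho>) z *\<^sub>R (1 / (w - z)))) \<partial>lborel)
     \<le> (\<integral>\<^sup>+z. ennreal (indicator (cball 0 R) (w - z) * inverse (norm (w - z))) \<partial>lborel)"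
  proof (intro nn_integral_mono)
    fix z
    have "norm (w - z) \<le> R" if "z \<in> cball p \<rho>"
      using assms that norm_triangle_ineq[of "w - p" "p - z"] by (simp add: dist_norm)
    then show "ennreal (norm (indicator (cball p \<rho>) z *\<^sub>R (1 / (w - z))))
        \<le> ennreal (indicator (cball 0 R) (w - z) * inverse (norm (w - z)))"
      by (auto simp: indicator_def norm_divide divide_inverse simp flip: norm_inverse)
  qed
  also have "\<dots> = (\<integral>\<^sup>+z. ennreal (indicator (cball 0 R) z * inverse (norm (z::complex))) \<partial>lborel)"
    by (subst (2) lborel_complex_reflect[of w, symmetric], subst nn_integral_distr) auto
  finally show ?thesis .
qed

lemma nn_integral_inverse_cmod_finite:
  "(\<integral>\<^sup>+z. ennreal (indicator (cball 0 R) z * inverse (norm (z::complex))) \<partial>lborel) < \<infinity>"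
  using integrable_lborel_inverse_cmod[of R]
  by (simp add: set_integrable_def integrable_iff_bounded abs_mult)

lemma Cauchy_kernel_disk_measurable [measurable]:
  "(\<lambda>z::complex. indicator (cball p \<rho>) z *\<^sub>R (1 / (w - z))) \<in> borel_measurable borel"
proof -
  have [measurable]: "cball p \<rho> \<in> sets (borel :: complex measure)" by simp
  show ?thesis by measurable
qed

text \<open>The exchange is legitimate because v is bounded on the interval and the kernel has
  uniformly bounded integral over the disk. Keeping v separate from \<eta> serves two purposes: with
  v the tangent it treats the winding number, with v = \<eta> / w a rotating phase it averages the
  kernel over rotations.\<close>

lemma integral_disk_Cauchy_kernel_curve:
  fixes \<eta> v :: "real \<Rightarrow> complex"
  assumes \<eta>: "continuous_on UNIV \<eta>" and v: "continuous_on UNIV v"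
  shows "(LINT z:cball p \<rho>|lborel. LINT t:{a..b}|lborel. v t / (\<eta> t - z))
     = integral {a..b} (\<lambda>t. v t * (LINT z:cball p \<rho>|lborel. 1 / (\<eta> t - z)))" (is ?eq)
    and "set_integrable lborel (cball p \<rho>) (\<lambda>z. LINT t:{a..b}|lborel. v t / (\<eta> t - z))" (is ?int)
    and "(\<lambda>t. v t * (LINT z:cball p \<rho>|lborel. 1 / (\<eta> t - z))) integrable_on {a..b}" (is ?int2)
proof -
  have [measurable]: "cball p \<rho> \<in> sets (borel :: complex measure)" by simp
  have [measurable]: "\<eta> \<in> borel_measurable borel" "v \<in> borel_measurable borel"
    using \<eta> v by (auto intro: borel_measurable_continuous_onI)
  define f where "f t z = indicator {a..b} t *\<^sub>R (v t * (indicator (cball p \<rho>) z *\<^sub>R (1 / (\<eta> t - z))))" for t z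
  have f[measurable]: "case_prod f \<in> borel_measurable (lborel \<Otimes>\<^sub>M lborel)"
    unfolding f_def by measurable
  have "compact (\<eta> ` {a..b})" "compact (v ` {a..b})"
    using \<eta> v by (auto intro!: compact_continuous_image intro: continuous_on_subset)
  then obtain A B where AB: "\<And>t. t \<in> {a..b} \<Longrightarrow> norm (\<eta> t) \<le> A" "\<And>t. t \<in> {a..b} \<Longrightarrow> norm (v t) \<le> B"
    by (metis (no_types) bounded_iff compact_imp_bounded imageI)
  define C where "C = (\<integral>\<^sup>+z. ennreal (indicator (cball 0 (A + norm p + \<rho>)) z * inverse (norm (z::complex))) \<partial>lborel)"
  have C: "C < \<infinity>" unfolding C_def by (rule nn_integral_inverse_cmod_finite)
  have int: "integrable (lborel \<Otimes>\<^sub>M lborel) (case_prod f)"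
  proof (rule integrableI_bounded)
    have "(\<integral>\<^sup>+x. ennreal (norm (case_prod f x)) \<partial>(lborel \<Otimes>\<^sub>M lborel))
        = (\<integral>\<^sup>+t. \<integral>\<^sup>+z. ennreal (norm (f t z)) \<partial>lborel \<partial>lborel)"
      by (subst lborel.nn_integral_fst[symmetric]) auto
    also have "\<dots> \<le> (\<integral>\<^sup>+t. (ennreal B * C) * indicator {a..b} t \<partial>lborel)"
    proof (rule nn_integral_mono)
      fix t
      show "(\<integral>\<^sup>+z. ennreal (norm (f t z)) \<partial>lborel) \<le> ennreal B * C * indicator {a..b} t"
      proof (cases "t \<in> {a..b}")
        case True
        have n: "norm (f t z) = norm (v t) * norm (indicator (cball p \<rho>) z *\<^sub>R (1 / (\<eta> t - z)))" for z
          using True by (simp add: f_def norm_mult norm_divide)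
        have "(\<integral>\<^sup>+z. ennreal (norm (f t z)) \<partial>lborel)
            = ennreal (norm (v t)) * (\<integral>\<^sup>+z. ennreal (norm (indicator (cball p \<rho>) z *\<^sub>R (1 / (\<eta> t - z)))) \<partial>lborel)"
          unfolding n by (subst nn_integral_cmult[symmetric]) (auto simp: ennreal_mult')
        also have "\<dots> \<le> ennreal B * C"
        proof -
          have "norm (\<eta> t - p) + \<rho> \<le> A + norm p + \<rho>"
            using AB(1)[OF True] norm_triangle_ineq4[of "\<eta> t" p] by linarith
          then show ?thesis
            unfolding C_def using AB(2)[OF True]
            by (intro mult_mono nn_integral_disk_Cauchy_kernel_le ennreal_leI) auto
        qed
        finally show ?thesis using True by simp
      qed (simp add: f_def)
    qed
    also have "\<dots> = ennreal B * C * emeasure lborel {a..b}"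
      by (subst nn_integral_cmult_indicator) auto
    also have "\<dots> < \<infinity>" using C by (simp add: ennreal_mult_less_top emeasure_lborel_Icc_eq)
    finally show "(\<integral>\<^sup>+x. ennreal (norm (case_prod f x)) \<partial>(lborel \<Otimes>\<^sub>M lborel)) < \<infinity>" .
  qed (rule f)
  have 1: "(\<integral>z. f t z \<partial>lborel) = indicator {a..b} t *\<^sub>R (v t * (LINT z:cball p \<rho>|lborel. 1 / (\<eta> t - z)))" for t
    unfolding f_def set_lebesgue_integral_def
    by (simp only: integral_scaleR_right integral_mult_right_zero)
  have 2: "(\<integral>t. f t z \<partial>lborel) = indicator (cball p \<rho>) z *\<^sub>R (LINT t:{a..b}|lborel. v t / (\<eta> t - z))" for z
    by (simp add: f_def set_lebesgue_integral_def indicator_def)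
  have i1: "set_integrable lborel {a..b} (\<lambda>t. v t * (LINT z:cball p \<rho>|lborel. 1 / (\<eta> t - z)))"
    using lborel_pair.integrable_fst[OF int] unfolding 1 set_integrable_def .
  then show ?int2 by (rule set_borel_integral_eq_integral(1))
  show ?int
    using lborel_pair.integrable_snd[OF int] unfolding 2 set_integrable_def .
  have "(\<integral>z. (\<integral>t. f t z \<partial>lborel) \<partial>lborel) = (\<integral>t. (\<integral>z. f t z \<partial>lborel) \<partial>lborel)"
    by (rule lborel_pair.Fubini_integral[OF int])
  moreover have "(\<integral>t. (\<integral>z. f t z \<partial>lborel) \<partial>lborel) = integral {a..b} (\<lambda>t. v t * (LINT z:cball p \<rho>|lborel. 1 / (\<eta> t - z)))"
    using set_borel_integral_eq_integral(2)[OF i1] unfolding 1 set_lebesgue_integral_def .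
  moreover have "(\<integral>z. (\<integral>t. f t z \<partial>lborel) \<partial>lborel) = (LINT z:cball p \<rho>|lborel. LINT t:{a..b}|lborel. v t / (\<eta> t - z))"
    unfolding 2 by (simp only: set_lebesgue_integral_def)
  ultimately show ?eq by simp
qed

lemma disk_Cauchy_kernel_rotate:
  "cis t * (LINT z:cball 0 \<rho>|lborel. 1 / (cis t * w - z)) = (LINT z:cball 0 \<rho>|lborel. 1 / (w - z))"
proof -
  have "(LINT z:cball 0 \<rho>|lborel. 1 / (cis t * w - z))
     = (\<integral>z. indicator (cball 0 \<rho>) (cis t * z) *\<^sub>R (1 / (cis t * w - cis t * z)) \<partial>lborel)"
    unfolding set_lebesgue_integral_def
    by (subst distr_lborel_rotate[of "cis t", symmetric], simp, subst integral_distr) auto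
  also have "(\<lambda>z. indicator (cball 0 \<rho>) (cis t * z) *\<^sub>R (1 / (cis t * w - cis t * z)))
      = (\<lambda>z. cis (-t) * (indicator (cball 0 \<rho>) z *\<^sub>R (1 / (w - z))))"
    by (auto simp: indicator_def norm_mult divide_inverse simp flip: right_diff_distrib cis_inverse)
  also have "(\<integral>z. cis (-t) * (indicator (cball 0 \<rho>) z *\<^sub>R (1 / (w - z))) \<partial>lborel)
      = cis (-t) * (LINT z:cball 0 \<rho>|lborel. 1 / (w - z))"
    unfolding set_lebesgue_integral_def by (rule integral_mult_right_zero)
  finally show ?thesis
    by (simp add: cis_mult mult.assoc[symmetric])
qed

text \<open>The integral equals its average over all rotations of w. After exchanging the integrals,
  the inner one runs over a circle and is 2 \<pi> / w for points z closer to 0 than w, and 0 for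
  points farther away. What remains is the area of the disk of radius
  \<open>min \<rho> (norm w)\<close>, divided by w.\<close>

lemma integral_disk_Cauchy_kernel_0:
  assumes "\<rho> \<ge> 0"
  shows "(LINT z:cball 0 \<rho>|lborel. 1 / (w - z)) = of_real pi * disk_kernel \<rho> w"
proof -
  let ?I = "\<lambda>w. LINT z:cball 0 \<rho>|lborel. 1 / (w - z)"
  have "2 * of_real pi * ?I w = integral {0..2*pi} (\<lambda>t. cis (-t) * ?I (cis (-t) * w))"
    by (subst disk_Cauchy_kernel_rotate) (simp add: scaleR_conv_of_real)
  also have "\<dots> = (LINT z:cball 0 \<rho>|lborel. LINT t:{0..2*pi}|lborel. cis (-t) / (cis (-t) * w - z))"
    by (intro integral_disk_Cauchy_kernel_curve(1)[symmetric] continuous_intros)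
  also have "\<dots> = (LINT z|lborel. (2 * of_real pi / w) * indicat_real (cball (0::complex) (min \<rho> (norm w))) z)"
    unfolding set_lebesgue_integral_def[of lborel "cball 0 \<rho>"]
  proof (rule Bochner_Integration.integral_cong_AE)
    show "(\<lambda>z. indicator (cball 0 \<rho>) z *\<^sub>R (LINT t:{0..2*pi}|lborel. cis (-t) / (cis (-t) * w - z)))
        \<in> borel_measurable lborel"
    proof -
      have "set_integrable lborel (cball 0 \<rho>) (\<lambda>z. LINT t:{0..2*pi}|lborel. cis (-t) / (cis (-t) * w - z))"
        by (intro integral_disk_Cauchy_kernel_curve(2) continuous_intros)
      then show ?thesis
        unfolding set_integrable_def by (rule borel_measurable_integrable)
    qed
    show "(\<lambda>z. (2 * of_real pi / w) * indicat_real (cball (0::complex) (min \<rho> (norm w))) z) \<in> borel_measurable lborel"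
    proof -
      have [measurable]: "cball 0 (min \<rho> (norm w)) \<in> sets (borel :: complex measure)" by simp
      show ?thesis by measurable
    qed
    \<comment> \<open>On this circle the rotated kernel has a pole on the path of integration, so
      the circle is removed as a null set.\<close>
    have "sphere 0 (norm w) \<in> null_sets (lborel :: complex measure)"
      using negligible_sphere[of "0::complex" "norm w"]
      by (simp add: negligible_iff_null_sets null_sets_completion_iff)
    then have "AE z::complex in lborel. norm z \<noteq> norm w"
      by (auto dest!: AE_not_in)
    then show "AE z in lborel. indicator (cball 0 \<rho>) z *\<^sub>R (LINT t:{0..2*pi}|lborel. cis (-t) / (cis (-t) * w - z))
        = (2 * of_real pi / w) * indicat_real (cball (0::complex) (min \<rho> (norm w))) z"
    proof eventually_elim
      case (elim z)
      have nz: "w - cis t * z \<noteq> 0" for t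
      proof
        assume "w - cis t * z = 0"
        then have "norm w = norm (cis t * z)" by simp
        then show False using elim by (simp add: norm_mult)
      qed
      have e: "cis (-t) / (cis (-t) * w - z) = 1 / (w - cis t * z)" for t
      proof -
        have "cis (-t) * w - z = cis (-t) * (w - cis t * z)"
          by (simp add: right_diff_distrib mult.assoc[symmetric] cis_mult)
        then show ?thesis by simp
      qed
      have "set_integrable lborel {0..2*pi} (\<lambda>t. 1 / (w - cis t * z))"
        using nz by (intro borel_integrable_atLeastAtMost') (auto intro!: continuous_intros)
      from set_borel_integral_eq_integral(2)[OF this]
      have "(LINT t:{0..2*pi}|lborel. 1 / (w - cis t * z)) = (if norm z < norm w then 2 * of_real pi / w else 0)"
        using has_integral_circle_Cauchy_kernel[OF elim] by (simp add: integral_unique)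
      then show ?case using elim unfolding e by (auto simp: indicator_def)
    qed
  qed
  also have "\<dots> = (2 * of_real pi / w) * of_real (pi * (min \<rho> (norm w))\<^sup>2)"
    using assms by (simp add: content_cball unit_ball_vol_2)
  also have "\<dots> = 2 * of_real pi * (of_real pi * disk_kernel \<rho> w)"
  \<comment> \<open>For w = 0 division by zero gives 0, which is also the value \<open>cnj 0\<close>
    of the kernel.\<close>
  proof (cases "norm w \<le> \<rho> \<and> w \<noteq> 0")
    case True
    then have "min \<rho> (norm w) = norm w" "complex_of_real ((norm w)\<^sup>2) = w * cnj w"
      by (auto simp: complex_norm_square[symmetric])
    then have "(2 * of_real pi / w) * of_real (pi * (min \<rho> (norm w))\<^sup>2)
        = (2 * of_real pi / w) * (of_real pi * (w * cnj w))"
      by (metis of_real_mult)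
    then show ?thesis using True by (simp add: disk_kernel_def)
  qed (use assms in \<open>auto simp: disk_kernel_def min_def\<close>)
  finally show ?thesis by simp
qed

lemma integral_disk_Cauchy_kernel:
  assumes "\<rho> \<ge> 0"
  shows "(LINT z:cball p \<rho>|lborel. 1 / (w - z)) = of_real pi * disk_kernel \<rho> (w - p)"
proof -
  have "(LINT z:cball p \<rho>|lborel. 1 / (w - z))
    = (\<integral>z. indicator (cball p \<rho>) (p + z) *\<^sub>R (1 / (w - (p + z))) \<partial>lborel)"
    unfolding set_lebesgue_integral_def
    by (subst lborel_distr_plus[of p, symmetric], subst integral_distr) auto
  also have "\<dots> = (LINT z:cball 0 \<rho>|lborel. 1 / (w - p - z))"
    by (simp add: set_lebesgue_integral_def indicator_def dist_norm diff_diff_eq)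
  finally show ?thesis using integral_disk_Cauchy_kernel_0[OF assms] by simp
qed

section \<open>Area as a curve integral\<close>

locale loop =
  fixes L :: real and \<gamma> T T' :: "real \<Rightarrow> complex"
  assumes L_pos: "L > 0"
    and periodic: "\<gamma> (s + L) = \<gamma> s"
    and deriv: "(\<gamma> has_vector_derivative T s) (at s)"
    and deriv2: "(T has_vector_derivative T' s) (at s)"
    and norm_T: "norm (T s) = 1"
    and simple: "simple_path (\<lambda>t. \<gamma> (L * t))"
begin

lemma continuous_gamma: "continuous_on S \<gamma>"
  using deriv by (intro continuous_at_imp_continuous_on) (auto intro: has_vector_derivative_continuous)

lemma continuous_T: "continuous_on S T"
  using deriv2 by (intro continuous_at_imp_continuous_on) (auto intro: has_vector_derivative_continuous)

lemma boundary_eq_path_image: "boundary (L, \<gamma>) = path_image (\<lambda>t. \<gamma> (L * t))"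
proof -
  have "{0..L} = (\<lambda>t. L * t) ` {0..1}"
    using L_pos by (simp add: image_mult_atLeastAtMost)
  then show ?thesis by (simp add: boundary_def path_image_def image_image)
qed

lemma deriv_unit_param:
  "((\<lambda>t. \<gamma> (L * t)) has_vector_derivative L *\<^sub>R T (L * t)) (at t within S)"
proof -
  have "((\<lambda>t. L * t) has_vector_derivative L) (at t within S)"
    by (auto intro!: derivative_eq_intros simp flip: has_real_derivative_iff_has_vector_derivative)
  from vector_diff_chain_within[OF this has_vector_derivative_at_within[OF deriv]]
  show ?thesis by (simp add: o_def)
qed

lemma valid_path_unit_param: "valid_path (\<lambda>t. \<gamma> (L * t))"
proof -
  have "(\<lambda>t. \<gamma> (L * t)) C1_differentiable_on {0..1}"
    unfolding C1_differentiable_on_def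
    using deriv_unit_param continuous_T
    by (intro exI[of _ "\<lambda>t. L *\<^sub>R T (L * t)"])
      (auto intro!: continuous_intros continuous_on_compose2[OF continuous_T[of UNIV]])
  then show ?thesis
    unfolding valid_path_def by (rule C1_differentiable_imp_piecewise)
qed

lemma closed_boundary: "closed (boundary (L, \<gamma>))"
  unfolding boundary_eq_path_image
  using valid_path_unit_param by (intro closed_path_image valid_path_imp_path)

lemma negligible_boundary: "negligible (boundary (L, \<gamma>))"
  unfolding boundary_def prod.case
proof (rule negligible_differentiable_image_lowdim)
  show "\<gamma> differentiable_on {0..L}"
    using deriv unfolding differentiable_on_def has_vector_derivative_def
    by (blast intro: differentiableI differentiable_at_withinI)
qed simp

lemma winding_number_unit_param:
  assumes "z \<notin> boundary (L, \<gamma>)"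
  shows "winding_number (\<lambda>t. \<gamma> (L * t)) z = 1 / (2 * pi * \<i>) * integral {0..L} (\<lambda>t. T t / (\<gamma> t - z))"
proof -
  have nz: "\<gamma> t - z \<noteq> 0" if "t \<in> {0..L}" for t using assms that by (auto simp: boundary_def)
  have "contour_integral (\<lambda>t. \<gamma> (L * t)) (\<lambda>w. 1 / (w - z))
      = integral {0..1} (\<lambda>t. L *\<^sub>R (T (L * t) / (\<gamma> (L * t) - z)))"
    unfolding contour_integral_integral
    by (simp add: vector_derivative_at[OF deriv_unit_param] scaleR_conv_of_real)
  also have "((\<lambda>t. L *\<^sub>R (T (L * t) / (\<gamma> (L * t) - z))) has_integral integral {L*0..L*1} (\<lambda>t. T t / (\<gamma> t - z))) {0..1}"
    using L_pos nz
    by (intro has_integral_substitution[where c=0 and d=L])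
      (auto intro!: continuous_intros continuous_gamma continuous_T derivative_eq_intros mult_left_le)
  then have "integral {0..1} (\<lambda>t. L *\<^sub>R (T (L * t) / (\<gamma> (L * t) - z))) = integral {0..L} (\<lambda>t. T t / (\<gamma> t - z))"
    by (metis (no_types, lifting) integral_unique mult_zero_right mult.right_neutral)
  finally show ?thesis
    using assms valid_path_unit_param by (subst winding_number_valid_path) (auto simp: boundary_eq_path_image)
qed

text \<open>The winding number is 1 inside and 0 outside, so integrating its Cauchy integral over
  the disk gives 2 \<pi> \<i> times the area; Fubini rewrites the left side through the Cauchy
  transform of the disk. When the disk contains the whole curve the kernel is conjugation, and the
  formula becomes the classical area formula by line integral.\<close>

lemma area_fun_eq_kernel:
  assumes ccw: "counterclockwise (L, \<gamma>)" and "\<rho> \<ge> 0"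
  shows "area_fun (L, \<gamma>) s \<rho> = 1/2 * Im (integral {0..L} (\<lambda>t. T t * disk_kernel \<rho> (\<gamma> t - \<gamma> s)))"
    and "(\<lambda>t. T t * disk_kernel \<rho> (\<gamma> t - \<gamma> s)) integrable_on {0..L}"
proof -
  let ?B = "boundary (L, \<gamma>)"
  let ?D = "cball (\<gamma> s) \<rho>"
  let ?J = "\<lambda>z. LINT t:{0..L}|lborel. T t / (\<gamma> t - z)"
  have [measurable]: "?D \<in> sets borel" "inside ?B \<in> sets borel" "?B \<in> sets borel"
    using closed_boundary open_inside[OF closed_boundary] by auto
  have J: "?J z = (if z \<in> inside ?B then 2 * pi * \<i> else 0)" if z: "z \<notin> ?B" for z
  proof -
    have "set_integrable lborel {0..L} (\<lambda>t. T t / (\<gamma> t - z))"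
      using z by (intro borel_integrable_atLeastAtMost')
        (auto intro!: continuous_intros continuous_gamma continuous_T simp: boundary_def)
    then have "?J z = integral {0..L} (\<lambda>t. T t / (\<gamma> t - z))"
      by (rule set_borel_integral_eq_integral(2))
    also have "\<dots> = 2 * pi * \<i> * winding_number (\<lambda>t. \<gamma> (L * t)) z"
      using winding_number_unit_param[OF z] by (simp add: field_simps)
    also have "winding_number (\<lambda>t. \<gamma> (L * t)) z = (if z \<in> inside ?B then 1 else 0)"
    proof (cases "z \<in> inside ?B")
      case True
      then show ?thesis using ccw by (auto simp: counterclockwise_def unit_param_def)
    next
      case False
      then have "z \<in> outside ?B" using z inside_Un_outside[of ?B] by blast
      moreover have "pathfinish (\<lambda>t. \<gamma> (L * t)) = pathstart (\<lambda>t. \<gamma> (L * t))"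
        using periodic[of 0] by (simp add: pathfinish_def pathstart_def)
      ultimately show ?thesis
        using False valid_path_unit_param
        by (simp add: winding_number_zero_in_outside valid_path_imp_path boundary_eq_path_image)
    qed
    finally show ?thesis by simp
  qed
  have neg: "?B \<in> null_sets lborel"
    using negligible_boundary by (simp add: negligible_iff_null_sets null_sets_completion_iff)
  have "(LINT z:?D|lborel. ?J z) = (LINT z|lborel. (2 * pi * \<i>) * indicat_real (inside ?B \<inter> ?D) z)"
    unfolding set_lebesgue_integral_def[of lborel ?D]
  proof (rule Bochner_Integration.integral_cong_AE)
    have "set_integrable lborel ?D ?J"
      by (intro integral_disk_Cauchy_kernel_curve(2) continuous_gamma continuous_T)
    then show "(\<lambda>z. indicator ?D z *\<^sub>R ?J z) \<in> borel_measurable lborel"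
      unfolding set_integrable_def by (rule borel_measurable_integrable)
    show "(\<lambda>z. (2 * pi * \<i>) * indicat_real (inside ?B \<inter> ?D) z) \<in> borel_measurable lborel"
      by measurable
    show "AE z in lborel. indicator ?D z *\<^sub>R ?J z = (2 * pi * \<i>) * indicat_real (inside ?B \<inter> ?D) z"
      using AE_not_in[OF neg] by eventually_elim (auto simp: J indicator_def)
  qed
  also have "\<dots> = (2 * pi * \<i>) * measure lborel (inside ?B \<inter> ?D)"
    by simp
  finally have 1: "(LINT z:?D|lborel. ?J z) = (2 * pi * \<i>) * measure lborel (inside ?B \<inter> ?D)" .
  have 2: "(LINT z:?D|lborel. ?J z) = integral {0..L} (\<lambda>t. T t * (of_real pi * disk_kernel \<rho> (\<gamma> t - \<gamma> s)))"
    by (subst integral_disk_Cauchy_kernel_curve(1)[OF continuous_gamma continuous_T])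
      (simp add: integral_disk_Cauchy_kernel[OF \<open>\<rho> \<ge> 0\<close>])
  have 3: "(\<lambda>t. T t * (of_real pi * disk_kernel \<rho> (\<gamma> t - \<gamma> s))) integrable_on {0..L}"
    using integral_disk_Cauchy_kernel_curve(3)[OF continuous_gamma continuous_T, of "\<gamma> s" \<rho> 0 L]
    by (simp add: integral_disk_Cauchy_kernel[OF \<open>\<rho> \<ge> 0\<close>])
  from integrable_on_cmult_left[OF 3, of "inverse (of_real pi)"]
  show 4: "(\<lambda>t. T t * disk_kernel \<rho> (\<gamma> t - \<gamma> s)) integrable_on {0..L}"
    by (simp add: field_simps)
  have "(2 * pi * \<i>) * measure lborel (inside ?B \<inter> ?D) = of_real pi * integral {0..L} (\<lambda>t. T t * disk_kernel \<rho> (\<gamma> t - \<gamma> s))"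
    unfolding 1[symmetric] 2 by (subst integral_mult_right[symmetric]) (simp add: mult_ac)
  then have "integral {0..L} (\<lambda>t. T t * disk_kernel \<rho> (\<gamma> t - \<gamma> s)) = 2 * \<i> * measure lborel (inside ?B \<inter> ?D)"
    by (simp add: mult.assoc)
  then have 5: "measure lborel (inside ?B \<inter> ?D) = 1/2 * Im (integral {0..L} (\<lambda>t. T t * disk_kernel \<rho> (\<gamma> t - \<gamma> s)))"
    by (simp only:) simp
  have "measure lebesgue (region (L, \<gamma>) \<inter> ?D) = measure lebesgue (inside ?B \<inter> ?D)"
  proof (rule measure_negligible_symdiff)
    show "inside ?B \<inter> ?D \<in> lmeasurable"
      by (intro bounded_set_imp_lmeasurable) (auto intro: bounded_subset[OF bounded_cball])
    show "negligible ((inside ?B \<inter> ?D - region (L, \<gamma>) \<inter> ?D) \<union> (region (L, \<gamma>) \<inter> ?D - inside ?B \<inter> ?D))"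
      by (rule negligible_subset[OF negligible_boundary]) (auto simp: region_def)
  qed
  with 5 show "area_fun (L, \<gamma>) s \<rho> = 1/2 * Im (integral {0..L} (\<lambda>t. T t * disk_kernel \<rho> (\<gamma> t - \<gamma> s)))"
    by (simp add: area_fun_def)
qed

end

section \<open>Crossings of a level\<close>

text \<open>At the smallest point of the level set the derivative cannot be negative, since f would
  then exceed c just before it. Nonvanishing of the derivative is assumed only where f \<le> c
  because the graph condition controls only the part of the curve inside the disk.\<close>

lemma first_crossing:
  fixes f f' :: "real \<Rightarrow> real"
  assumes "a < b" and cont: "continuous_on {a..b} f" and ends: "f a < c" "c < f b"
    and der: "\<And>t. t \<in> {a<..<b} \<Longrightarrow> (f has_real_derivative f' t) (at t)"
    and nz: "\<And>t. t \<in> {a<..<b} \<Longrightarrow> f t \<le> c \<Longrightarrow> f' t \<noteq> 0"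
  obtains t where "t \<in> {a<..<b}" "f t = c" "f' t > 0" "\<And>u. u \<in> {a<..<t} \<Longrightarrow> f u < c"
proof -
  define K where "K = {t \<in> {a..b}. f t = c}"
  have "closed K"
    unfolding K_def using cont by (intro continuous_closed_preimage_constant) auto
  then have "compact K"
    unfolding K_def by (metis (no_types, lifting) bounded_closed_interval bounded_subset compact_eq_bounded_closed mem_Collect_eq subsetI)
  moreover have "\<exists>t\<ge>a. t \<le> b \<and> f t = c"
    using \<open>a < b\<close> ends cont by (intro IVT') auto
  then have "K \<noteq> {}" by (auto simp: K_def)
  ultimately obtain t where t: "t \<in> K" "\<And>u. u \<in> K \<Longrightarrow> t \<le> u"
    using compact_attains_inf[of K] by blast
  then have tab: "t \<in> {a<..<b}" and ft: "f t = c"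
    using ends by (auto simp: K_def less_le)
  have less: "f u < c" if u: "u \<in> {a..<t}" for u
  proof (rule ccontr)
    assume "\<not> f u < c"
    then have "\<exists>v\<ge>a. v \<le> u \<and> f v = c"
      using u tab ends by (intro IVT' continuous_on_subset[OF cont]) auto
    then obtain v where "a \<le> v" "v \<le> u" "f v = c" by blast
    then have "v \<in> K" using u tab by (auto simp: K_def)
    then show False using t(2)[of v] \<open>v \<le> u\<close> u by auto
  qed
  have "\<not> f' t < 0"
  proof
    assume "f' t < 0"
    from DERIV_neg_dec_left[OF der[OF tab] this] obtain d
      where d: "d > 0" "\<And>h. 0 < h \<Longrightarrow> h < d \<Longrightarrow> f t < f (t - h)" by blast
    define h where "h = min (d/2) ((t - a)/2)"
    have "0 < h" "h < d" "t - h \<in> {a..<t}" using d tab by (auto simp: h_def min_def field_simps)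
    then show False using d(2)[of h] less[of "t - h"] ft by auto
  qed
  with nz[OF tab] ft have "f' t > 0" by force
  then show thesis using that[OF tab ft] less by auto
qed

lemma last_crossing:
  fixes f f' :: "real \<Rightarrow> real"
  assumes "a < b" and cont: "continuous_on {a..b} f" and ends: "c < f a" "f b < c"
    and der: "\<And>t. t \<in> {a<..<b} \<Longrightarrow> (f has_real_derivative f' t) (at t)"
    and nz: "\<And>t. t \<in> {a<..<b} \<Longrightarrow> f t \<le> c \<Longrightarrow> f' t \<noteq> 0"
  obtains t where "t \<in> {a<..<b}" "f t = c" "f' t < 0" "\<And>u. u \<in> {t<..<b} \<Longrightarrow> f u < c"
proof -
  have "((\<lambda>t. f (- t)) has_real_derivative - f' (- t)) (at t)" if "t \<in> {-b<..<-a}" for t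
    using der[of "-t"] that by (simp add: DERIV_mirror)
  moreover have "continuous_on {-b..-a} (\<lambda>t. f (- t))"
    by (rule continuous_on_compose2[OF cont]) (auto intro!: continuous_intros)
  ultimately obtain t where t: "t \<in> {-b<..<-a}" "f (-t) = c" "- f' (-t) > 0"
      "\<And>u. u \<in> {-b<..<t} \<Longrightarrow> f (-u) < c"
    using first_crossing[of "-b" "-a" "\<lambda>t. f (-t)" c "\<lambda>t. - f' (-t)"] assms by auto
  show thesis
  proof (rule that[of "-t"])
    show "f u < c" if "u \<in> {-t<..<b}" for u using t(4)[of "-u"] that by auto
  qed (use t in auto)
qed

text \<open>The derivative makes q positive just after a, and by the intermediate value theorem a
  later nonpositive value would force another zero. This is how the sign of the tangential component
  of a chord is found.\<close>

lemma positive_after_zero: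
  fixes q :: "real \<Rightarrow> real"
  assumes "a < b" and cont: "continuous_on {a..b} q" and "q a = 0"
    and der: "(q has_real_derivative d) (at a)" and "d > 0"
    and nz: "\<And>t. t \<in> {a<..b} \<Longrightarrow> q t \<noteq> 0"
  shows "q b > 0"
proof (rule ccontr)
  assume "\<not> q b > 0"
  from DERIV_pos_inc_right[OF der \<open>d > 0\<close>] obtain e
    where e: "e > 0" "\<And>h. 0 < h \<Longrightarrow> h < e \<Longrightarrow> q a < q (a + h)" by blast
  define c where "c = a + min (e/2) ((b - a)/2)"
  have c: "a < c" "c < b" "q c > 0"
    using e(1) e(2)[of "min (e/2) ((b - a)/2)"] assms by (auto simp: c_def min_def field_simps)
  have "\<exists>t\<ge>c. t \<le> b \<and> q t = 0"
    using c \<open>\<not> q b > 0\<close> by (intro IVT2' continuous_on_subset[OF cont]) auto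
  then show False using nz c by force
qed

text \<open>The mean value theorem in t turns \<open>E y (\<tau> y) = 0\<close> into an equation for
  the increment of \<tau>, and the limit is taken in the quotient. Continuity of \<tau> is a
  hypothesis since \<tau> is obtained by choice; differentiability of E in y is required only at y0,
  at the fixed second argument \<open>\<tau> y0\<close>.\<close>

lemma implicit_derivative:
  fixes E E' :: "real \<Rightarrow> real \<Rightarrow> real" and \<tau> :: "real \<Rightarrow> real"
  assumes lim: "(\<tau> \<longlongrightarrow> \<tau> y0) (at y0)"
    and zero: "\<forall>\<^sub>F y in nhds y0. E y (\<tau> y) = 0"
    and dy: "((\<lambda>y. E y (\<tau> y0)) has_real_derivative e) (at y0)"
    and dt: "\<And>y t. (E y has_real_derivative E' y t) (at t)"
    and cont: "((\<lambda>(y, t). E' y t) \<longlongrightarrow> E' y0 (\<tau> y0)) (nhds (y0, \<tau> y0))"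
    and nz: "E' y0 (\<tau> y0) \<noteq> 0"
  shows "(\<tau> has_real_derivative - e / E' y0 (\<tau> y0)) (at y0)"
proof -
  \<comment> \<open>Stating the bound by the distance to \<open>\<tau> y0\<close> covers both orders
    of the two arguments and the case of equality.\<close>
  have "\<exists>\<xi>. \<bar>\<xi> - \<tau> y0\<bar> \<le> \<bar>\<tau> y - \<tau> y0\<bar> \<and> E y (\<tau> y) - E y (\<tau> y0) = (\<tau> y - \<tau> y0) * E' y \<xi>" for y
  proof (cases "\<tau> y" "\<tau> y0" rule: linorder_cases)
    case less
    from MVT2[OF less, of "E y" "E' y"] dt obtain z where "\<tau> y < z" "z < \<tau> y0"
      "E y (\<tau> y0) - E y (\<tau> y) = (\<tau> y0 - \<tau> y) * E' y z" by blast
    then show ?thesis by (intro exI[of _ z]) (auto simp: algebra_simps)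
  next
    case greater
    from MVT2[OF greater, of "E y" "E' y"] dt obtain z where "\<tau> y0 < z" "z < \<tau> y"
      "E y (\<tau> y) - E y (\<tau> y0) = (\<tau> y - \<tau> y0) * E' y z" by blast
    then show ?thesis by (intro exI[of _ z]) auto
  qed auto
  then obtain \<xi> where \<xi>: "\<And>y. \<bar>\<xi> y - \<tau> y0\<bar> \<le> \<bar>\<tau> y - \<tau> y0\<bar>"
    "\<And>y. E y (\<tau> y) - E y (\<tau> y0) = (\<tau> y - \<tau> y0) * E' y (\<xi> y)" by metis
  have "((\<lambda>y. \<tau> y - \<tau> y0) \<longlongrightarrow> 0) (at y0)"
    using lim by (simp add: LIM_zero)
  then have "((\<lambda>y. \<xi> y - \<tau> y0) \<longlongrightarrow> 0) (at y0)"
    by (rule Lim_null_comparison[rotated, OF tendsto_rabs_zero]) (use \<xi>(1) in auto)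
  then have "(\<xi> \<longlongrightarrow> \<tau> y0) (at y0)" by (rule LIM_zero_cancel)
  then have "((\<lambda>y. (y, \<xi> y)) \<longlongrightarrow> (y0, \<tau> y0)) (at y0)"
    by (intro tendsto_intros)
  from filterlim_compose[OF cont this]
  have lim': "((\<lambda>y. E' y (\<xi> y)) \<longlongrightarrow> E' y0 (\<tau> y0)) (at y0)" by simp
  have z0: "E y0 (\<tau> y0) = 0" using eventually_nhds_x_imp_x[OF zero] .
  have "((\<lambda>y. - ((E y (\<tau> y0) - E y0 (\<tau> y0)) / (y - y0)) / E' y (\<xi> y)) \<longlongrightarrow> - e / E' y0 (\<tau> y0)) (at y0)"
    using dy nz lim' by (intro tendsto_intros) (auto simp: has_field_derivative_iff)
  then have "((\<lambda>y. (\<tau> y - \<tau> y0) / (y - y0)) \<longlongrightarrow> - e / E' y0 (\<tau> y0)) (at y0)"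
  proof (rule Lim_transform_eventually)
    have "\<forall>\<^sub>F y in at y0. E' y (\<xi> y) \<noteq> 0"
      using tendsto_imp_eventually_ne[OF lim' nz] .
    moreover have "\<forall>\<^sub>F y in at y0. E y (\<tau> y) = 0"
      using zero by (simp add: eventually_nhds_conv_at)
    ultimately show "\<forall>\<^sub>F y in at y0. - ((E y (\<tau> y0) - E y0 (\<tau> y0)) / (y - y0)) / E' y (\<xi> y) = (\<tau> y - \<tau> y0) / (y - y0)"
    proof eventually_elim
      case (elim y)
      then have "E y (\<tau> y0) = - ((\<tau> y - \<tau> y0) * E' y (\<xi> y))" using \<xi>(2)[of y] by simp
      then show ?case using elim z0 by simp
    qed
  qed
  then show ?thesis by (simp add: has_field_derivative_iff)
qed

text \<open>F is negative, positive, negative on the three parts of the window. Its sign at three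
  test points l < m < u around the crossings persists for y near y0, and this traps
  \<open>\<tau> y\<close> between l and m and \<open>\<sigma> y\<close> between m and u. Only
  continuity in y at each fixed t enters, since the test points do not move.\<close>

lemma crossing_tendsto:
  fixes F :: "real \<Rightarrow> real \<Rightarrow> real"
  assumes cont: "\<And>t. isCont (\<lambda>y. F y t) y0"
    and ab: "isCont a y0" "isCont b y0"
    and ev: "\<forall>\<^sub>F y in nhds y0. a y < \<tau> y \<and> \<tau> y < \<sigma> y \<and> \<sigma> y < b y \<and>
      (\<forall>t\<in>{a y<..<\<tau> y} \<union> {\<sigma> y<..<b y}. F y t < 0) \<and> (\<forall>t\<in>{\<tau> y<..<\<sigma> y}. F y t > 0) \<and>
      F y (\<tau> y) = 0 \<and> F y (\<sigma> y) = 0"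
  shows "(\<tau> \<longlongrightarrow> \<tau> y0) (at y0)" "(\<sigma> \<longlongrightarrow> \<sigma> y0) (at y0)"
proof -
  note 0 = eventually_nhds_x_imp_x[OF ev]
  have pos: "\<forall>\<^sub>F y in at y0. F y t > 0" if "t \<in> {\<tau> y0<..<\<sigma> y0}" for t
    using cont[of t] 0 that by (auto simp: isCont_def intro: order_tendstoD)
  have neg: "\<forall>\<^sub>F y in at y0. F y t < 0" if "t \<in> {a y0<..<\<tau> y0} \<union> {\<sigma> y0<..<b y0}" for t
    using cont[of t] 0 that by (auto simp: isCont_def intro: order_tendstoD)
  have evn: "\<forall>\<^sub>F y in at y0. t > a y" if "t > a y0" for t
    using ab that by (auto simp: isCont_def intro: order_tendstoD)
  have evn': "\<forall>\<^sub>F y in at y0. t < b y" if "t < b y0" for t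
    using ab that by (auto simp: isCont_def intro: order_tendstoD)
  have ev': "\<forall>\<^sub>F y in at y0. a y < \<tau> y \<and> \<tau> y < \<sigma> y \<and> \<sigma> y < b y \<and>
      (\<forall>t\<in>{a y<..<\<tau> y} \<union> {\<sigma> y<..<b y}. F y t < 0) \<and> (\<forall>t\<in>{\<tau> y<..<\<sigma> y}. F y t > 0) \<and>
      F y (\<tau> y) = 0 \<and> F y (\<sigma> y) = 0"
    using ev by (simp add: eventually_nhds_conv_at)
  have between: "\<forall>\<^sub>F y in at y0. l < \<tau> y \<and> \<tau> y < m \<and> m < \<sigma> y \<and> \<sigma> y < u"
    if "a y0 < l" "l < \<tau> y0" "\<tau> y0 < m" "m < \<sigma> y0" "\<sigma> y0 < u" "u < b y0" for l m u
  proof -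
    have "\<forall>\<^sub>F y in at y0. F y m > 0" "\<forall>\<^sub>F y in at y0. F y l < 0" "\<forall>\<^sub>F y in at y0. F y u < 0"
      "\<forall>\<^sub>F y in at y0. a y < l" "\<forall>\<^sub>F y in at y0. u < b y"
      using that by (auto intro!: pos neg evn evn')
    then show ?thesis using ev'
    proof eventually_elim
      case (elim y)
      have m: "\<tau> y < m" "m < \<sigma> y"
        using elim that by (metis UnCI greaterThanLessThan_iff linorder_less_linear order_less_asym order_less_trans)+
      have "l < \<tau> y" using elim that m
        by (metis greaterThanLessThan_iff linorder_less_linear order_less_asym order_less_trans)
      moreover have "\<sigma> y < u" using elim that m
        by (metis greaterThanLessThan_iff linorder_less_linear order_less_asym order_less_trans)
      ultimately show ?case using m by blast
    qed
  qed
  \<comment> \<open>These are default test points; each of the four bounds below tightens one of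
    them and leaves the other two in place.\<close>
  obtain l0 u0 where lu: "a y0 < l0" "l0 < \<tau> y0" "\<sigma> y0 < u0" "u0 < b y0"
    using 0 dense by meson
  obtain m0 where m0: "\<tau> y0 < m0" "m0 < \<sigma> y0" using 0 dense by meson
  show "(\<tau> \<longlongrightarrow> \<tau> y0) (at y0)"
  proof (rule order_tendstoI)
    fix c assume "c < \<tau> y0"
    show "\<forall>\<^sub>F y in at y0. c < \<tau> y"
    proof (rule eventually_mono)
      show "\<forall>\<^sub>F y in at y0. (max l0 c) < \<tau> y \<and> \<tau> y < m0 \<and> m0 < \<sigma> y \<and> \<sigma> y < u0"
        by (rule between) (use lu m0 \<open>c < \<tau> y0\<close> in auto)
    qed auto
  next
    fix c assume "\<tau> y0 < c"
    show "\<forall>\<^sub>F y in at y0. \<tau> y < c"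
    proof (rule eventually_mono)
      show "\<forall>\<^sub>F y in at y0. l0 < \<tau> y \<and> \<tau> y < (min m0 c) \<and> (min m0 c) < \<sigma> y \<and> \<sigma> y < u0"
        by (rule between) (use lu m0 \<open>\<tau> y0 < c\<close> in auto)
    qed auto
  qed
  show "(\<sigma> \<longlongrightarrow> \<sigma> y0) (at y0)"
  proof (rule order_tendstoI)
    fix c assume "c < \<sigma> y0"
    show "\<forall>\<^sub>F y in at y0. c < \<sigma> y"
    proof (rule eventually_mono)
      show "\<forall>\<^sub>F y in at y0. l0 < \<tau> y \<and> \<tau> y < (max m0 c) \<and> (max m0 c) < \<sigma> y \<and> \<sigma> y < u0"
        by (rule between) (use lu m0 \<open>c < \<sigma> y0\<close> in auto)
    qed auto
  next
    fix c assume "\<sigma> y0 < c"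
    show "\<forall>\<^sub>F y in at y0. \<sigma> y < c"
    proof (rule eventually_mono)
      show "\<forall>\<^sub>F y in at y0. l0 < \<tau> y \<and> \<tau> y < m0 \<and> m0 < \<sigma> y \<and> \<sigma> y < (min u0 c)"
        by (rule between) (use lu m0 \<open>\<sigma> y0 < c\<close> in auto)
    qed auto
  qed
qed

section \<open>Crossings of the curve with a circle centred on it\<close>

context loop
begin

lemma periodic_int: "\<gamma> (s + of_int k * L) = \<gamma> s"
proof (induction k rule: int_induct[where k=0])
  case (step1 i)
  then show ?case using periodic[of "s + of_int i * L"] by (simp add: algebra_simps)
next
  case (step2 i)
  then show ?case using periodic[of "s + of_int (i - 1) * L"] by (simp add: algebra_simps)
qed simp

text \<open>Injectivity is given only on the base period, so s is shifted into it by a multiple of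
  L. The shifted t may lie beyond L, in which case one further period is subtracted.\<close>

lemma gamma_neq:
  assumes "s < t" "t < s + L"
  shows "\<gamma> t \<noteq> \<gamma> s"
proof
  assume eq: "\<gamma> t = \<gamma> s"
  define k where "k = \<lfloor>s / L\<rfloor>"
  define s0 where "s0 = s + of_int (- k) * L"
  define t0 where "t0 = t + of_int (- k) * L"
  have s0: "0 \<le> s0" "s0 < L"
    using floor_divide_lower[OF L_pos, of s] floor_divide_upper[OF L_pos, of s]
    by (auto simp: s0_def k_def algebra_simps)
  have st: "s0 < t0" "t0 < s0 + L" using assms by (auto simp: s0_def t0_def)
  have eq0: "\<gamma> t0 = \<gamma> s0" unfolding s0_def t0_def periodic_int by (rule eq)
  have inj: "u = v \<or> u = 0 \<and> v = L \<or> u = L \<and> v = 0"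
    if "u \<in> {0..L}" "v \<in> {0..L}" "\<gamma> u = \<gamma> v" for u v
  proof -
    have "u / L \<in> {0..1}" "v / L \<in> {0..1}" "\<gamma> (L * (u / L)) = \<gamma> (L * (v / L))"
      using that L_pos by auto
    then have "u / L = v / L \<or> u / L = 0 \<and> v / L = 1 \<or> u / L = 1 \<and> v / L = 0"
      using simple unfolding simple_path_def loop_free_def by blast
    then show ?thesis using L_pos by auto
  qed
  show False
  proof (cases "t0 < L")
    case True
    then show False using inj[of t0 s0] eq0 s0 st by auto
  next
    case False
    then show False using inj[of "t0 - L" s0] periodic[of "t0 - L"] eq0 s0 st by auto
  qed
qed

text \<open>The period is cut open at the centre s itself, so that the excursion outside the disk is
  one interval instead of wrapping around the base point. The signs of the radial speed record that
  the curve exits at t1 and reenters at t2, both transversally.\<close>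

definition crossing :: "real \<Rightarrow> real \<Rightarrow> real \<Rightarrow> real \<Rightarrow> bool" where
  "crossing s x t1 t2 \<longleftrightarrow> s < t1 \<and> t1 < t2 \<and> t2 < s + L \<and>
    (\<forall>t\<in>{s<..<t1} \<union> {t2<..<s + L}. norm (\<gamma> t - \<gamma> s) < x) \<and>
    (\<forall>t\<in>{t1<..<t2}. norm (\<gamma> t - \<gamma> s) > x) \<and>
    norm (\<gamma> t1 - \<gamma> s) = x \<and> norm (\<gamma> t2 - \<gamma> s) = x \<and>
    (\<gamma> t1 - \<gamma> s) \<bullet> T t1 > 0 \<and> (\<gamma> t2 - \<gamma> s) \<bullet> T t2 < 0"

lemma deriv_dist_sq:
  "((\<lambda>t. (norm (\<gamma> t - p))\<^sup>2) has_real_derivative 2 * ((\<gamma> t - p) \<bullet> T t)) (at t)"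
proof -
  have "((\<lambda>t. (\<gamma> t - p) \<bullet> (\<gamma> t - p)) has_derivative (\<lambda>h. (\<gamma> t - p) \<bullet> (h *\<^sub>R T t) + (h *\<^sub>R T t) \<bullet> (\<gamma> t - p))) (at t)"
    using deriv[of t] unfolding has_vector_derivative_def
    by (auto intro!: derivative_eq_intros)
  then show ?thesis
    unfolding has_field_derivative_def power2_norm_eq_inner
    by (rule has_derivative_eq_rhs) (auto simp: fun_eq_iff inner_commute)
qed

lemma deriv_inner:
  "((\<lambda>t. (\<gamma> t - p) \<bullet> v) has_real_derivative T t \<bullet> v) (at t)"
proof -
  have "((\<lambda>t. (\<gamma> t - p) \<bullet> v) has_derivative (\<lambda>h. (h *\<^sub>R T t) \<bullet> v)) (at t)"
    using deriv[of t] unfolding has_vector_derivative_def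
    by (auto intro!: derivative_eq_intros)
  then show ?thesis
    by (simp add: has_field_derivative_def mult_commute_abs)
qed

lemma continuous_on_dist: "continuous_on S (\<lambda>t. norm (\<gamma> t - p))"
  by (intro continuous_intros continuous_gamma)

text \<open>The squared distance to the centre has no critical point in the disk other than the
  centre. Its maximum over a period is therefore attained outside the disk. The first crossing
  before the maximum is t1 and the last one after it is t2; a return to the disk in between would
  produce an interior minimum, again a critical point.\<close>

lemma ex_crossing:
  assumes "x > 0" and nz: "\<And>t. t \<in> {s<..<s + L} \<Longrightarrow> norm (\<gamma> t - \<gamma> s) \<le> x \<Longrightarrow> (\<gamma> t - \<gamma> s) \<bullet> T t \<noteq> 0"
  obtains t1 t2 where "crossing s x t1 t2"
proof -
  let ?n = "\<lambda>t. norm (\<gamma> t - \<gamma> s)"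
  let ?E = "\<lambda>t. (?n t)\<^sup>2"
  have sL: "s < s + L" using L_pos by simp
  have contE: "continuous_on S ?E" for S
    by (intro continuous_intros continuous_gamma)
  have sq1: "?E t \<le> x\<^sup>2 \<longleftrightarrow> ?n t \<le> x" for t
    using \<open>x > 0\<close> abs_le_square_iff[of "?n t" x] by simp
  have sq2: "x\<^sup>2 \<le> ?E t \<longleftrightarrow> x \<le> ?n t" for t
    using \<open>x > 0\<close> abs_le_square_iff[of x "?n t"] by simp
  have sq: "?E t < x\<^sup>2 \<longleftrightarrow> ?n t < x" "x\<^sup>2 < ?E t \<longleftrightarrow> x < ?n t" "?E t = x\<^sup>2 \<longleftrightarrow> ?n t = x" for t
    using sq1[of t] sq2[of t] by (auto simp: less_le_not_le)
  have dnz: "2 * ((\<gamma> t - \<gamma> s) \<bullet> T t) \<noteq> 0" if "t \<in> {s<..<s + L}" "?E t \<le> x\<^sup>2" for t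
    using nz that sq1 by auto
  obtain m where m: "m \<in> {s..s + L}" "\<And>t. t \<in> {s..s + L} \<Longrightarrow> ?E t \<le> ?E m"
    using continuous_attains_sup[of "{s..s + L}" ?E] contE sL by auto
  have "?E (s + L / 2) > 0" using gamma_neq[of s "s + L/2"] L_pos by simp
  then have "?E m > 0" using m(2)[of "s + L/2"] L_pos by auto
  then have "\<gamma> m \<noteq> \<gamma> s" by auto
  then have mi: "m \<in> {s<..<s + L}" using m(1) periodic[of s] by (cases "m = s"; cases "m = s + L") auto
  have m_gt: "?E m > x\<^sup>2"
  proof (rule ccontr)
    assume "\<not> ?E m > x\<^sup>2"
    moreover have "2 * ((\<gamma> m - \<gamma> s) \<bullet> T m) = 0"
    proof (rule DERIV_local_max[OF deriv_dist_sq])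
      show "0 < min (m - s) (s + L - m)" using mi by auto
      show "\<forall>y. \<bar>m - y\<bar> < min (m - s) (s + L - m) \<longrightarrow> ?E y \<le> ?E m"
        by (intro allI impI m(2)) (auto simp: abs_if split: if_splits)
    qed
    ultimately show False using dnz[OF mi] by auto
  qed
  have "?E s < x\<^sup>2" "?E (s + L) < x\<^sup>2" using \<open>x > 0\<close> periodic[of s] by auto
  obtain t1 where t1: "t1 \<in> {s<..<m}" "?E t1 = x\<^sup>2" "2 * ((\<gamma> t1 - \<gamma> s) \<bullet> T t1) > 0"
      "\<And>u. u \<in> {s<..<t1} \<Longrightarrow> ?E u < x\<^sup>2"
  proof (rule first_crossing[of s m ?E "x\<^sup>2" "\<lambda>t. 2 * ((\<gamma> t - \<gamma> s) \<bullet> T t)"])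
    fix t assume "t \<in> {s<..<m}" "?E t = x\<^sup>2" "2 * ((\<gamma> t - \<gamma> s) \<bullet> T t) > 0"
      "\<And>u. u \<in> {s<..<t} \<Longrightarrow> ?E u < x\<^sup>2"
    then show thesis by (rule that)
  next
    fix t assume "t \<in> {s<..<m}" "?E t \<le> x\<^sup>2"
    with mi show "2 * ((\<gamma> t - \<gamma> s) \<bullet> T t) \<noteq> 0" by (intro dnz) auto
  qed (use mi \<open>x > 0\<close> in \<open>auto intro: contE deriv_dist_sq \<open>?E s < x\<^sup>2\<close> m_gt\<close>)
  obtain t2 where t2: "t2 \<in> {m<..<s + L}" "?E t2 = x\<^sup>2" "2 * ((\<gamma> t2 - \<gamma> s) \<bullet> T t2) < 0"
      "\<And>u. u \<in> {t2<..<s + L} \<Longrightarrow> ?E u < x\<^sup>2"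
  proof (rule last_crossing[of m "s + L" ?E "x\<^sup>2" "\<lambda>t. 2 * ((\<gamma> t - \<gamma> s) \<bullet> T t)"])
    fix t assume "t \<in> {m<..<s + L}" "?E t = x\<^sup>2" "2 * ((\<gamma> t - \<gamma> s) \<bullet> T t) < 0"
      "\<And>u. u \<in> {t<..<s + L} \<Longrightarrow> ?E u < x\<^sup>2"
    then show thesis by (rule that)
  next
    fix t assume "t \<in> {m<..<s + L}" "?E t \<le> x\<^sup>2"
    with mi show "2 * ((\<gamma> t - \<gamma> s) \<bullet> T t) \<noteq> 0" by (intro dnz) auto
  qed (use mi \<open>x > 0\<close> in \<open>auto intro: contE deriv_dist_sq \<open>?E (s + L) < x\<^sup>2\<close> m_gt\<close>)
  have "t1 < t2" using t1 t2 by auto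
  obtain l where l: "l \<in> {t1..t2}" "\<And>t. t \<in> {t1..t2} \<Longrightarrow> ?E l \<le> ?E t"
    using continuous_attains_inf[of "{t1..t2}" ?E] contE \<open>t1 < t2\<close> by auto
  have crit: "?E u > x\<^sup>2" if u: "u \<in> {t1<..<t2}" "\<And>t. t \<in> {t1..t2} \<Longrightarrow> ?E u \<le> ?E t" for u
  proof (rule ccontr)
    assume "\<not> ?E u > x\<^sup>2"
    moreover have "2 * ((\<gamma> u - \<gamma> s) \<bullet> T u) = 0"
    proof (rule DERIV_local_min[OF deriv_dist_sq])
      show "0 < min (u - t1) (t2 - u)" using u by auto
      show "\<forall>y. \<bar>u - y\<bar> < min (u - t1) (t2 - u) \<longrightarrow> ?E u \<le> ?E y"
        by (intro allI impI u(2)) (auto simp: abs_if split: if_splits)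
    qed
    ultimately show False using dnz[of u] u t1 t2 mi by auto
  qed
  have El: "?E l = x\<^sup>2"
  proof (cases "l \<in> {t1<..<t2}")
    case True
    then show ?thesis using crit[OF True l(2)] l(2)[of t1] t1 \<open>t1 < t2\<close> by auto
  next
    case False
    then have "l = t1 \<or> l = t2" using l(1) by auto
    then show ?thesis using t1 t2 by auto
  qed
  \<comment> \<open>The minimum over the middle interval is x^2, so a point u violating the claim is
    itself a minimum, and the exclusion of interior minima in the disk applies to u.\<close>
  have mid: "?E u > x\<^sup>2" if u: "u \<in> {t1<..<t2}" for u
  proof (rule ccontr)
    assume "\<not> ?E u > x\<^sup>2"
    then have "?E u \<le> ?E t" if "t \<in> {t1..t2}" for t using l(2)[OF that] El by linarith
    from crit[OF u this] \<open>\<not> ?E u > x\<^sup>2\<close> show False by simp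
  qed
  have "crossing s x t1 t2"
    unfolding crossing_def using t1 t2 mi mid \<open>t1 < t2\<close> by (auto simp: sq)
  then show thesis by (rule that)
qed

text \<open>The critical parameters on the closed middle interval form a compact set on which the
  distance attains a minimum, and that minimum exceeds x. The gap provides crossings for radii
  slightly above x, which a derivative at x in the radius requires.\<close>

lemma crossing_extend:
  assumes cr: "crossing s x t1 t2" and "x > 0"
    and nz: "\<And>t. t \<in> {s<..<s + L} \<Longrightarrow> norm (\<gamma> t - \<gamma> s) \<le> x \<Longrightarrow> (\<gamma> t - \<gamma> s) \<bullet> T t \<noteq> 0"
  obtains R where "R > x" "\<And>t. t \<in> {s<..<s + L} \<Longrightarrow> norm (\<gamma> t - \<gamma> s) \<le> R \<Longrightarrow> (\<gamma> t - \<gamma> s) \<bullet> T t \<noteq> 0"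
proof -
  define K where "K = {t \<in> {t1..t2}. (\<gamma> t - \<gamma> s) \<bullet> T t = 0}"
  have out: "norm (\<gamma> t - \<gamma> s) \<le> x" if "t \<in> {s<..<s+L}" "t \<notin> {t1..t2}" for t
  proof -
    have "t \<in> {s<..<t1} \<union> {t2<..<s + L}" using that by auto
    then show ?thesis using cr unfolding crossing_def by (meson less_imp_le)
  qed
  show thesis
  proof (cases "K = {}")
    case True
    show thesis
    proof (rule that[of "x + 1"])
      show "(\<gamma> t - \<gamma> s) \<bullet> T t \<noteq> 0" if "t \<in> {s<..<s + L}" for t
        using True nz[OF that] out[OF that] by (cases "t \<in> {t1..t2}") (auto simp: K_def)
    qed simp
  next
    case False
    have "continuous_on {t1..t2} (\<lambda>t. (\<gamma> t - \<gamma> s) \<bullet> T t)"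
      by (intro continuous_intros continuous_gamma continuous_T)
    then have "closed K"
      unfolding K_def by (intro continuous_closed_preimage_constant) auto
    moreover have "bounded K" unfolding K_def by (rule bounded_subset[OF bounded_closed_interval[of t1 t2]]) auto
    ultimately have "compact K" by (simp add: compact_eq_bounded_closed)
    then obtain k where k: "k \<in> K" "\<And>t. t \<in> K \<Longrightarrow> norm (\<gamma> k - \<gamma> s) \<le> norm (\<gamma> t - \<gamma> s)"
      using continuous_attains_inf[OF _ False continuous_on_dist] by blast
    have "norm (\<gamma> k - \<gamma> s) > x"
    proof (rule ccontr)
      assume "\<not> norm (\<gamma> k - \<gamma> s) > x"
      then show False using nz[of k] k(1) cr by (auto simp: K_def crossing_def)
    qed
    then obtain R where R: "x < R" "R < norm (\<gamma> k - \<gamma> s)" using dense by blast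
    show thesis
    proof (rule that[OF R(1)])
      fix t assume t: "t \<in> {s<..<s + L}" "norm (\<gamma> t - \<gamma> s) \<le> R"
      show "(\<gamma> t - \<gamma> s) \<bullet> T t \<noteq> 0"
      proof (cases "t \<in> {t1..t2}")
        case True
        then show ?thesis using k(2)[of t] t R by (auto simp: K_def)
      next
        case False
        then show ?thesis using nz[OF t(1)] out[OF t(1)] by blast
      qed
    qed
  qed
qed

lemma T_periodic: "T (s + L) = T s"
proof -
  have "((\<lambda>t. t + L) has_vector_derivative 1) (at s)"
    by (auto intro!: derivative_eq_intros simp flip: has_real_derivative_iff_has_vector_derivative)
  from vector_diff_chain_at[OF this deriv]
  have "(\<gamma> has_vector_derivative T (s + L)) (at s)" by (simp add: o_def periodic)
  then show ?thesis using deriv vector_derivative_unique_at by blast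
qed

text \<open>The tangential component of the chord starts at 0 with slope 1 and has no zero while the
  curve stays in the disk. The second sign is the same argument run backwards in time from
  \<open>s + L\<close>.\<close>

lemma crossing_signs:
  assumes cr: "crossing s x t1 t2"
    and nz: "\<And>t. t \<in> {s<..<s + L} \<Longrightarrow> norm (\<gamma> t - \<gamma> s) \<le> x \<Longrightarrow> (\<gamma> t - \<gamma> s) \<bullet> T s \<noteq> 0"
  shows "(\<gamma> t1 - \<gamma> s) \<bullet> T s > 0" "(\<gamma> t2 - \<gamma> s) \<bullet> T s < 0"
proof -
  have TT: "T s \<bullet> T s = 1" using norm_T[of s] by (simp add: norm_eq_sqrt_inner)
  note per = T_periodic[of s]
  show "(\<gamma> t1 - \<gamma> s) \<bullet> T s > 0"
  proof (rule positive_after_zero[where a=s and q="\<lambda>t. (\<gamma> t - \<gamma> s) \<bullet> T s" and d=1])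
    show "continuous_on {s..t1} (\<lambda>t. (\<gamma> t - \<gamma> s) \<bullet> T s)"
      by (intro continuous_intros continuous_gamma)
    show "((\<lambda>t. (\<gamma> t - \<gamma> s) \<bullet> T s) has_real_derivative 1) (at s)"
      using deriv_inner[of "\<gamma> s" "T s" s] TT by simp
    show "(\<gamma> t - \<gamma> s) \<bullet> T s \<noteq> 0" if "t \<in> {s<..t1}" for t
    proof (rule nz)
      show "t \<in> {s<..<s + L}" using that cr by (auto simp: crossing_def)
      show "norm (\<gamma> t - \<gamma> s) \<le> x"
        using that cr by (cases "t = t1") (auto simp: crossing_def less_imp_le)
    qed
  qed (use cr in \<open>auto simp: crossing_def\<close>)
  have "- ((\<gamma> (- (- t2)) - \<gamma> s) \<bullet> T s) > 0"
  proof (rule positive_after_zero[where a="-(s + L)" and q="\<lambda>t. - ((\<gamma> (- t) - \<gamma> s) \<bullet> T s)" and d=1])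
    show "continuous_on {-(s + L)..-t2} (\<lambda>t. - ((\<gamma> (- t) - \<gamma> s) \<bullet> T s))"
      by (intro continuous_intros continuous_on_compose2[OF continuous_gamma[of UNIV]]) auto
    show "((\<lambda>t. - ((\<gamma> (- t) - \<gamma> s) \<bullet> T s)) has_real_derivative 1) (at (-(s + L)))"
    proof -
      have "((\<lambda>t. (\<gamma> t - \<gamma> s) \<bullet> T s) has_real_derivative 1) (at (- (- (s + L))))"
        using deriv_inner[of "\<gamma> s" "T s" "s + L"] by (simp only: minus_minus per TT)
      from DERIV_minus[OF DERIV_mirror[THEN iffD1, OF this]] show ?thesis by (simp only: minus_minus)
    qed
    show "- ((\<gamma> (- t) - \<gamma> s) \<bullet> T s) \<noteq> 0" if "t \<in> {-(s + L)<..-t2}" for t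
    proof -
      have "-t \<in> {s<..<s + L}" using that cr by (auto simp: crossing_def)
      moreover have "norm (\<gamma> (-t) - \<gamma> s) \<le> x"
        using that cr by (cases "t = -t2") (auto simp: crossing_def less_imp_le)
      ultimately show ?thesis using nz[of "-t"] by simp
    qed
  qed (use cr periodic[of s] in \<open>auto simp: crossing_def add.commute\<close>)
  then show "(\<gamma> t2 - \<gamma> s) \<bullet> T s < 0" by simp
qed

end

section \<open>Derivatives of the area\<close>

text \<open>The Lipschitz constant dominates all difference quotients, so dominated convergence
  applies along every sequence. The finite set N allows for the parameters at which the curve meets
  the circle, where the kernel fails to be differentiable.\<close>

lemma has_real_derivative_integral_Lipschitz:
  fixes f :: "real \<Rightarrow> real \<Rightarrow> real"
  assumes "e > 0" and int: "\<And>y. \<bar>y - y0\<bar> < e \<Longrightarrow> f y integrable_on {a..b}"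
    and lip: "\<And>y t. \<bar>y - y0\<bar> < e \<Longrightarrow> t \<in> {a..b} \<Longrightarrow> \<bar>f y t - f y0 t\<bar> \<le> B * \<bar>y - y0\<bar>"
    and N: "finite N"
    and der: "\<And>t. t \<in> {a..b} - N \<Longrightarrow> ((\<lambda>y. f y t) has_real_derivative g t) (at y0)"
  shows "((\<lambda>y. integral {a..b} (f y)) has_real_derivative integral {a..b} g) (at y0)"
  unfolding has_field_derivative_iff tendsto_at_iff_sequentially
proof (intro allI impI)
  fix X :: "nat \<Rightarrow> real"
  assume X: "\<forall>i. X i \<in> UNIV - {y0}" "X \<longlonglongrightarrow> y0"
  then have "\<forall>\<^sub>F i in sequentially. \<bar>X i - y0\<bar> < e"
    using \<open>e > 0\<close> by (auto dest: tendstoD simp: dist_real_def)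
  then obtain n where n: "\<And>i. i \<ge> n \<Longrightarrow> \<bar>X i - y0\<bar> < e" by (auto simp: eventually_sequentially)
  \<comment> \<open>The shift by n keeps every term within distance e of y0.\<close>
  define q where "q i t = (f (X (i + n)) t - f y0 t) / (X (i + n) - y0)" for i t
  \<comment> \<open>Setting the quotients to 0 on N gives convergence at every point of the interval
    without changing any integral.\<close>
  define q0 where "q0 i t = (if t \<in> N then 0 else q i t)" for i t
  define g0 where "g0 t = (if t \<in> N then 0 else g t)" for t
  have intq: "q i integrable_on {a..b}" for i
    unfolding q_def using int n \<open>e > 0\<close> by (intro integrable_on_divide integrable_diff) auto
  have intq0: "q0 i integrable_on {a..b}" for i
    by (rule integrable_spike_finite[OF N _ intq]) (auto simp: q0_def)
  have le: "norm (q0 i t) \<le> \<bar>B\<bar>" if "t \<in> {a..b}" for i t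
  proof -
    have "\<bar>X (i + n) - y0\<bar> > 0" using X by auto
    moreover have "\<bar>f (X (i + n)) t - f y0 t\<bar> \<le> B * \<bar>X (i + n) - y0\<bar>"
      using n that by (intro lip) auto
    then have "\<bar>f (X (i + n)) t - f y0 t\<bar> \<le> \<bar>B\<bar> * \<bar>X (i + n) - y0\<bar>"
      by (rule order_trans) (auto intro: mult_right_mono)
    ultimately show ?thesis by (auto simp: q0_def q_def abs_divide divide_le_eq)
  qed
  have conv: "(\<lambda>i. q0 i t) \<longlonglongrightarrow> g0 t" if "t \<in> {a..b}" for t
  proof (cases "t \<in> N")
    case False
    then have "((\<lambda>y. (f y t - f y0 t) / (y - y0)) \<longlongrightarrow> g t) (at y0)"
      using der that by (simp add: has_field_derivative_iff)
    moreover have "filterlim (\<lambda>i. X (i + n)) (at y0) sequentially"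
      using X LIMSEQ_ignore_initial_segment[OF X(2), of n] by (auto simp: filterlim_at)
    ultimately have "(\<lambda>i. q i t) \<longlonglongrightarrow> g t"
      unfolding q_def by (rule filterlim_compose)
    then show ?thesis using False by (simp add: q0_def g0_def)
  qed (simp add: q0_def g0_def)
  have "(\<lambda>i. integral {a..b} (q0 i)) \<longlonglongrightarrow> integral {a..b} g0"
    by (rule dominated_convergence(2)[OF intq0 _ le conv]) auto
  also have "integral {a..b} g0 = integral {a..b} g"
    by (rule integral_spike[of N]) (use N in \<open>auto simp: g0_def\<close>)
  also have "(\<lambda>i. integral {a..b} (q0 i)) = (\<lambda>i. integral {a..b} (q i))"
    by (intro ext integral_spike[of N]) (use N in \<open>auto simp: q0_def\<close>)
  also have "\<dots> = (\<lambda>i. (integral {a..b} (f (X (i + n))) - integral {a..b} (f y0)) / (X (i + n) - y0))"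
    unfolding q_def using int n \<open>e > 0\<close> by (auto simp: integral_diff)
  finally show "((\<lambda>y. (integral {a..b} (f y) - integral {a..b} (f y0)) / (y - y0)) \<circ> X) \<longlonglongrightarrow> integral {a..b} g"
    unfolding o_def by (rule LIMSEQ_offset)
qed

text \<open>Up to conjugation the kernel is the identity inside the circle and inversion in the
  circle outside. It folds the plane into the disk, and this folding does not increase
  distances.\<close>

lemma disk_kernel_Lipschitz:
  assumes "\<rho> > 0"
  shows "norm (disk_kernel \<rho> w - disk_kernel \<rho> v) \<le> norm (w - v)"
proof -
  have mixed: "norm (cnj w - of_real (\<rho>\<^sup>2) / v) \<le> norm (w - v)" if w: "norm w \<le> \<rho>" and v: "\<rho> < norm v" for w v
  proof -
    define a b where "a = w / \<rho>" and "b = v / \<rho>"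
    have ab: "norm a \<le> 1" "norm b > 1" "w = \<rho> * a" "v = \<rho> * b" "b \<noteq> 0"
      using w v \<open>\<rho> > 0\<close> by (auto simp: a_def b_def norm_divide)
    define x where "x = Re (cnj a * b)"
    have x: "x \<le> norm b"
    proof -
      have "x \<le> norm a * norm b"
        using complex_Re_le_cmod[of "cnj a * b"] unfolding x_def norm_mult complex_mod_cnj .
      also have "\<dots> \<le> norm b" using ab by (intro mult_left_le_one_le) auto
      finally show ?thesis .
    qed
    have "(norm (cnj a * b - 1))\<^sup>2 = (norm a)\<^sup>2 * (norm b)\<^sup>2 - 2 * x + 1"
      by (simp add: x_def cmod_power2) (simp add: power2_eq_square algebra_simps)
    moreover have "(norm (b * (a - b)))\<^sup>2 = (norm b)\<^sup>2 * ((norm a)\<^sup>2 - 2 * x + (norm b)\<^sup>2)"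
      by (simp add: x_def cmod_power2) (simp add: power2_eq_square algebra_simps)
    \<comment> \<open>This product is exactly the difference of the two squared norms above. The
      second factor is at least the square of \<open>norm b - 1\<close> because x is at most
      \<open>norm b\<close>.\<close>
    moreover have "0 \<le> ((norm b)\<^sup>2 - 1) * ((norm b)\<^sup>2 + 1 - 2 * x)"
    proof (rule mult_nonneg_nonneg)
      show "0 \<le> (norm b)\<^sup>2 - 1" using ab power_mono[of 1 "norm b" 2] by simp
      have "0 \<le> (norm b - 1)\<^sup>2" by simp
      also have "\<dots> = (norm b)\<^sup>2 + 1 - 2 * norm b" by (simp add: power2_diff)
      finally show "0 \<le> (norm b)\<^sup>2 + 1 - 2 * x" using x by simp
    qed
    ultimately have "(norm (cnj a * b - 1))\<^sup>2 \<le> (norm (b * (a - b)))\<^sup>2"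
      by (simp add: algebra_simps power2_eq_square)
    then have "norm (cnj a * b - 1) \<le> norm b * norm (a - b)"
      by (simp add: norm_mult power2_le_iff_abs_le abs_mult)
    then have "norm (cnj a * b - 1) / norm b \<le> norm (a - b)"
      using ab by (simp add: divide_le_eq mult.commute)
    moreover have "cnj a - 1 / b = (cnj a * b - 1) / b" using ab by (simp add: field_simps)
    ultimately have le: "norm (cnj a - 1 / b) \<le> norm (a - b)" by (simp add: norm_divide)
    have "cnj w - of_real (\<rho>\<^sup>2) / v = \<rho> * (cnj a - 1 / b)" "w - v = \<rho> * (a - b)"
      using ab \<open>\<rho> > 0\<close> by (auto simp: field_simps power2_eq_square)
    then show ?thesis using le \<open>\<rho> > 0\<close> by (simp add: norm_mult)
  qed
  consider "norm w \<le> \<rho>" "norm v \<le> \<rho>" | "norm w \<le> \<rho>" "norm v > \<rho>"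
    | "norm w > \<rho>" "norm v \<le> \<rho>" | "norm w > \<rho>" "norm v > \<rho>" by linarith
  then show ?thesis
  proof cases
    case 1
    then show ?thesis by (simp add: disk_kernel_def flip: complex_cnj_diff)
  next
    case 2
    then show ?thesis using mixed[of w v] by (simp add: disk_kernel_def)
  next
    case 3
    then show ?thesis using mixed[of v w] by (simp add: disk_kernel_def norm_minus_commute)
  next
    case 4
    then have nz: "w \<noteq> 0" "v \<noteq> 0" using \<open>\<rho> > 0\<close> by auto
    then have "of_real (\<rho>\<^sup>2) / w - of_real (\<rho>\<^sup>2) / v = of_real (\<rho>\<^sup>2) * (v - w) / (w * v)"
      by (simp add: field_simps)
    then have "norm (of_real (\<rho>\<^sup>2) / w - of_real (\<rho>\<^sup>2) / v) = \<rho>\<^sup>2 / (norm w * norm v) * norm (w - v)"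
      by (simp add: norm_mult norm_divide norm_power norm_minus_commute)
    also have "\<rho>\<^sup>2 / (norm w * norm v) \<le> 1"
      using 4 nz \<open>\<rho> > 0\<close> mult_mono[of \<rho> "norm w" \<rho> "norm v"] by (simp add: divide_le_eq power2_eq_square)
    then have "\<rho>\<^sup>2 / (norm w * norm v) * norm (w - v) \<le> 1 * norm (w - v)"
      by (rule mult_right_mono) simp
    finally show ?thesis using 4 by (simp add: disk_kernel_def)
  qed
qed

text \<open>A difference of squares leaves a sum of two lengths divided by \<open>norm w\<close>,
  each length being at most \<open>norm w\<close>; this is the origin of the constant 2.\<close>

lemma disk_kernel_Lipschitz_radius:
  assumes "\<rho> > 0" "\<sigma> > 0"
  shows "norm (disk_kernel \<rho> w - disk_kernel \<sigma> w) \<le> 2 * \<bar>\<rho> - \<sigma>\<bar>"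
proof -
  have mixed: "norm (cnj w - of_real (\<sigma>\<^sup>2) / w) \<le> 2 * \<bar>\<rho> - \<sigma>\<bar>" if "norm w \<le> \<rho>" "\<sigma> < norm w" "\<sigma> > 0" for \<rho> \<sigma>
  proof -
    have nz: "w \<noteq> 0" using that by auto
    have "cnj w - of_real (\<sigma>\<^sup>2) / w = of_real ((norm w)\<^sup>2 - \<sigma>\<^sup>2) / w"
      using nz complex_norm_square[of w] by (simp add: field_simps)
    then have "norm (cnj w - of_real (\<sigma>\<^sup>2) / w) = \<bar>(norm w)\<^sup>2 - \<sigma>\<^sup>2\<bar> / norm w"
      by (simp add: norm_divide del: of_real_diff)
    also have "\<dots> = (norm w - \<sigma>) * ((norm w + \<sigma>) / norm w)"
      using that by (simp add: power2_eq_square square_diff_square_factored abs_mult mult.commute)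
    also have "\<dots> \<le> (norm w - \<sigma>) * 2"
      using that by (intro mult_left_mono) (auto simp: divide_le_eq)
    finally show ?thesis using that by simp
  qed
  consider "norm w \<le> \<rho>" "norm w \<le> \<sigma>" | "norm w \<le> \<rho>" "norm w > \<sigma>"
    | "norm w > \<rho>" "norm w \<le> \<sigma>" | "norm w > \<rho>" "norm w > \<sigma>" by linarith
  then show ?thesis
  proof cases
    case 1
    then show ?thesis by (simp add: disk_kernel_def)
  next
    case 2
    then show ?thesis using mixed[of \<rho> \<sigma>] assms by (simp add: disk_kernel_def)
  next
    case 3
    then show ?thesis using mixed[of \<sigma> \<rho>] assms by (simp add: disk_kernel_def norm_minus_commute abs_minus_commute)
  next
    case 4
    then have nz: "w \<noteq> 0" using assms by auto
    have "of_real (\<rho>\<^sup>2) / w - of_real (\<sigma>\<^sup>2) / w = of_real (\<rho>\<^sup>2 - \<sigma>\<^sup>2) / w"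
      by (simp add: diff_divide_distrib)
    then have "norm (of_real (\<rho>\<^sup>2) / w - of_real (\<sigma>\<^sup>2) / w) = \<bar>\<rho>\<^sup>2 - \<sigma>\<^sup>2\<bar> / norm w"
      by (simp add: norm_divide del: of_real_diff)
    also have "\<dots> = \<bar>\<rho> - \<sigma>\<bar> * ((\<rho> + \<sigma>) / norm w)"
      using assms by (simp add: power2_eq_square square_diff_square_factored abs_mult mult.commute)
    also have "\<dots> \<le> \<bar>\<rho> - \<sigma>\<bar> * 2"
      using 4 nz by (intro mult_left_mono) (auto simp: divide_le_eq)
    finally show ?thesis using 4 by (simp add: disk_kernel_def)
  qed
qed

lemma Im_mult_of_real_divide: "Im (a * (of_real c / b)) = c * Im (a / b)"
proof -
  have "a * (of_real c / b) = of_real c * (a / b)" by simp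
  then show ?thesis by (simp only: Im_complex_of_real Re_complex_of_real times_complex.sel)
qed

lemma disk_kernel_outside: "\<rho> < norm w \<Longrightarrow> disk_kernel \<rho> w = of_real (\<rho>\<^sup>2) / w"
  by (simp add: disk_kernel_def)

lemma of_real_square_divide:
  fixes w :: complex
  assumes "w \<noteq> 0" "norm w = x"
  shows "of_real (x\<^sup>2) / w = cnj w"
proof -
  have "of_real (x\<^sup>2) = w * cnj w" by (simp only: assms(2)[symmetric] complex_norm_square)
  then show ?thesis using assms(1) by (simp only:) simp
qed

text \<open>The formulas come from differentiating the squared distance to the moving centre, set
  equal to the squared radius. Letting centre and radius both depend on y covers the two uses: fixed
  centre with growing radius, and fixed radius with the centre moving along the curve.\<close>

lemma (in loop) crossing_has_real_derivative:
  assumes S: "(S has_real_derivative S') (at y0)" and X: "(X has_real_derivative X') (at y0)"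
    and ev: "\<forall>\<^sub>F y in nhds y0. crossing (S y) (X y) (\<tau> y) (\<sigma> y)"
  shows "(\<tau> has_real_derivative (X y0 * X' + ((\<gamma> (\<tau> y0) - \<gamma> (S y0)) \<bullet> T (S y0)) * S') / ((\<gamma> (\<tau> y0) - \<gamma> (S y0)) \<bullet> T (\<tau> y0))) (at y0)"
    and "(\<sigma> has_real_derivative (X y0 * X' + ((\<gamma> (\<sigma> y0) - \<gamma> (S y0)) \<bullet> T (S y0)) * S') / ((\<gamma> (\<sigma> y0) - \<gamma> (S y0)) \<bullet> T (\<sigma> y0))) (at y0)"
proof -
  have SX: "isCont S y0" "isCont X y0" using S X by (auto intro: DERIV_isCont)
  have \<gamma>S: "isCont (\<lambda>y. \<gamma> (S y)) y0"
    using SX(1) deriv by (intro isCont_o2[OF SX(1)]) (auto intro: has_vector_derivative_continuous)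
  define F where "F y t = norm (\<gamma> t - \<gamma> (S y)) - X y" for y t
  have contF: "isCont (\<lambda>y. F y t) y0" for t
    unfolding F_def by (intro continuous_intros \<gamma>S SX)
  have ev': "\<forall>\<^sub>F y in nhds y0. S y < \<tau> y \<and> \<tau> y < \<sigma> y \<and> \<sigma> y < S y + L \<and>
      (\<forall>t\<in>{S y<..<\<tau> y} \<union> {\<sigma> y<..<S y + L}. F y t < 0) \<and> (\<forall>t\<in>{\<tau> y<..<\<sigma> y}. F y t > 0) \<and>
      F y (\<tau> y) = 0 \<and> F y (\<sigma> y) = 0"
    using ev by eventually_elim (auto simp: crossing_def F_def)
  have SL: "isCont (\<lambda>y. S y + L) y0" by (intro continuous_intros SX)
  note lims = crossing_tendsto[OF contF SX(1) SL ev']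
  define E where "E y t = (norm (\<gamma> t - \<gamma> (S y)))\<^sup>2 - (X y)\<^sup>2" for y t
  define E' where "E' y t = 2 * ((\<gamma> t - \<gamma> (S y)) \<bullet> T t)" for y t
  have dt: "(E y has_real_derivative E' y t) (at t)" for y t
    using DERIV_diff[OF deriv_dist_sq DERIV_const] unfolding E_def E'_def by simp
  have dy: "((\<lambda>y. E y t) has_real_derivative - 2 * ((\<gamma> t - \<gamma> (S y0)) \<bullet> T (S y0)) * S' - 2 * X y0 * X') (at y0)" for t
  proof -
    have "((\<lambda>u. (norm (\<gamma> u - \<gamma> t))\<^sup>2) has_real_derivative 2 * ((\<gamma> (S y0) - \<gamma> t) \<bullet> T (S y0))) (at (S y0))"
      by (rule deriv_dist_sq)
    from DERIV_chain2[OF this S]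
    have "((\<lambda>y. (norm (\<gamma> (S y) - \<gamma> t))\<^sup>2) has_real_derivative 2 * ((\<gamma> (S y0) - \<gamma> t) \<bullet> T (S y0)) * S') (at y0)" .
    then have "((\<lambda>y. (norm (\<gamma> (S y) - \<gamma> t))\<^sup>2 - (X y)\<^sup>2) has_real_derivative
        2 * ((\<gamma> (S y0) - \<gamma> t) \<bullet> T (S y0)) * S' - 2 * X y0 * X') (at y0)"
    proof (rule DERIV_diff)
      show "((\<lambda>y. (X y)\<^sup>2) has_real_derivative 2 * X y0 * X') (at y0)"
        using X by (auto intro!: derivative_eq_intros)
    qed
    then show ?thesis
      by (simp add: E_def norm_minus_commute inner_diff_left algebra_simps)
  qed
  have lim: "((\<lambda>(y, t). E' y t) \<longlongrightarrow> E' y0 t0) (nhds (y0, t0))" for t0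
  proof -
    have id: "((\<lambda>p. p) \<longlongrightarrow> (y0, t0)) (nhds (y0, t0))" by (simp add: filterlim_def)
    have "((\<lambda>p. \<gamma> (S (fst p))) \<longlongrightarrow> \<gamma> (S (fst (y0, t0)))) (nhds (y0, t0))"
      using isCont_tendsto_compose[OF \<gamma>S tendsto_fst[OF id, unfolded fst_conv]] by simp
    moreover have "((\<lambda>p. \<gamma> (snd p)) \<longlongrightarrow> \<gamma> (snd (y0, t0))) (nhds (y0, t0))"
      using isCont_tendsto_compose[OF has_vector_derivative_continuous[OF deriv] tendsto_snd[OF id, unfolded snd_conv]] by simp
    moreover have "((\<lambda>p. T (snd p)) \<longlongrightarrow> T (snd (y0, t0))) (nhds (y0, t0))"
      using isCont_tendsto_compose[OF has_vector_derivative_continuous[OF deriv2] tendsto_snd[OF id, unfolded snd_conv]] by simp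
    ultimately show ?thesis
      unfolding E'_def case_prod_beta by (auto intro!: tendsto_intros)
  qed
  have z: "\<forall>\<^sub>F y in nhds y0. E y (\<tau> y) = 0" "\<forall>\<^sub>F y in nhds y0. E y (\<sigma> y) = 0"
    using ev by (auto elim!: eventually_mono simp: crossing_def E_def)
  have c: "crossing (S y0) (X y0) (\<tau> y0) (\<sigma> y0)" by (rule eventually_nhds_x_imp_x[OF ev])
  have nz: "E' y0 (\<tau> y0) \<noteq> 0" "E' y0 (\<sigma> y0) \<noteq> 0" using c by (auto simp: crossing_def E'_def)
  have *: "- (- 2 * a * S' - 2 * X y0 * X') / (2 * b) = (X y0 * X' + a * S') / b" for a b :: real
    by (cases "b = 0") (auto simp: field_simps)
  show "(\<tau> has_real_derivative (X y0 * X' + ((\<gamma> (\<tau> y0) - \<gamma> (S y0)) \<bullet> T (S y0)) * S') / ((\<gamma> (\<tau> y0) - \<gamma> (S y0)) \<bullet> T (\<tau> y0))) (at y0)"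
    using implicit_derivative[OF lims(1) z(1) dy dt lim nz(1)] unfolding E'_def * .
  show "(\<sigma> has_real_derivative (X y0 * X' + ((\<gamma> (\<sigma> y0) - \<gamma> (S y0)) \<bullet> T (S y0)) * S') / ((\<gamma> (\<sigma> y0) - \<gamma> (S y0)) \<bullet> T (\<sigma> y0))) (at y0)"
    using implicit_derivative[OF lims(2) z(2) dy dt lim nz(2)] unfolding E'_def * .
qed

locale ccw_loop = loop +
  assumes ccw: "counterclockwise (L, \<gamma>)"
begin

text \<open>Crossings live on the period that starts at the centre, whereas the area formula
  integrates from 0. The integrand is periodic, so the window can be moved to the centre.\<close>

lemma area_fun_window:
  assumes "a \<in> {0..L}" "\<rho> \<ge> 0"
  shows "((\<lambda>t. Im (T t * disk_kernel \<rho> (\<gamma> t - \<gamma> s))) has_integral 2 * area_fun (L, \<gamma>) s \<rho>) {a..a + L}"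
proof -
  let ?f = "\<lambda>t. T t * disk_kernel \<rho> (\<gamma> t - \<gamma> s)"
  have int: "?f integrable_on {0..L}" by (rule area_fun_eq_kernel(2)[OF ccw assms(2)])
  have i1: "?f integrable_on {0..a}" "?f integrable_on {a..L}"
    using int assms by (auto intro: integrable_on_subinterval)
  have per: "?f (t + L) = ?f t" for t by (simp add: periodic T_periodic)
  have h1: "(?f has_integral integral {0..a} ?f) {L..a + L}"
    using integrable_integral[OF i1(1)] has_integral_shift_real_ivl_iff[of ?f _ L "a + L" L] by (simp add: per)
  have "(?f has_integral integral {a..L} ?f + integral {0..a} ?f) {a..a + L}"
    by (rule has_integral_combine[OF _ _ integrable_integral[OF i1(2)] h1]) (use assms in auto)
  also have "integral {a..L} ?f + integral {0..a} ?f = integral {0..L} ?f"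
    using Henstock_Kurzweil_Integration.integral_combine[OF _ _ int, of a] assms by (simp add: add.commute)
  finally have "(?f has_integral integral {0..L} ?f) {a..a + L}" .
  from has_integral_linear[OF this bounded_linear_Im]
  show ?thesis by (simp add: o_def area_fun_eq_kernel(1)[OF ccw assms(2)])
qed

text \<open>Where the curve lies inside the disk the kernel does not depend on the radius, so only
  the arc between t1 and t2 contributes. The imaginary part of the logarithmic integral is the angle
  swept as seen from the centre, and the derivative is the length of the circular arc inside the
  region.\<close>

lemma area_fun_deriv_radius:
  assumes "s \<in> {0..L}" "x > 0" and cr: "crossing s x t1 t2"
  shows "(area_fun (L, \<gamma>) s has_real_derivative x * Im (integral {t1..t2} (\<lambda>t. T t / (\<gamma> t - \<gamma> s)))) (at x)"
proof -
  let ?w = "\<lambda>t. \<gamma> t - \<gamma> s"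
  define f where "f y t = Im (T t * disk_kernel y (?w t))" for y t
  define g where "g t = (if t \<in> {t1..t2} then Im (T t * (2 * x / ?w t)) else 0)" for t
  \<comment> \<open>Besides the two crossings N contains the ends of the window, since
    \<open>crossing\<close> speaks only about open intervals.\<close>
  define N where "N = {s, t1, t2, s + L}"
  have c: "s < t1" "t1 < t2" "t2 < s + L" using cr by (auto simp: crossing_def)
  have nz: "?w t \<noteq> 0" if "t \<in> {t1..t2}" for t using gamma_neq[of s t] that c by auto
  have fI: "(f y has_integral 2 * area_fun (L, \<gamma>) s y) {s..s + L}" if "y \<ge> 0" for y
    unfolding f_def using area_fun_window[OF assms(1) that] .
  have "((\<lambda>y. integral {s..s + L} (f y)) has_real_derivative integral {s..s + L} g) (at x)"
  proof (rule has_real_derivative_integral_Lipschitz[where e=x and B=2 and N=N])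
    show "f y integrable_on {s..s + L}" if "\<bar>y - x\<bar> < x" for y
    proof -
      have "y \<ge> 0" using that by linarith
      then show ?thesis using fI unfolding integrable_on_def by blast
    qed
    show "\<bar>f y t - f x t\<bar> \<le> 2 * \<bar>y - x\<bar>" if "\<bar>y - x\<bar> < x" for y t
    proof -
      have "\<bar>f y t - f x t\<bar> = \<bar>Im (T t * (disk_kernel y (?w t) - disk_kernel x (?w t)))\<bar>"
        by (simp add: f_def algebra_simps)
      also have "\<dots> \<le> norm (T t * (disk_kernel y (?w t) - disk_kernel x (?w t)))"
        by (rule abs_Im_le_cmod)
      also have "\<dots> \<le> 2 * \<bar>y - x\<bar>"
        using disk_kernel_Lipschitz_radius[of y x "?w t"] that \<open>x > 0\<close> by (simp add: norm_mult norm_T)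
      finally show ?thesis .
    qed
    show "((\<lambda>y. f y t) has_real_derivative g t) (at x)" if t: "t \<in> {s..s + L} - N" for t
    proof (cases "t \<in> {t1..t2}")
      case True
      then have gt: "norm (?w t) > x" using cr t by (auto simp: crossing_def N_def)
      have "((\<lambda>y. Im (T t * (of_real (y\<^sup>2) / ?w t))) has_real_derivative Im (T t * (2 * x / ?w t))) (at x)"
      proof -
        have "((\<lambda>y. y\<^sup>2 * Im (T t / ?w t)) has_real_derivative 2 * x * Im (T t / ?w t)) (at x)"
          by (auto intro!: derivative_eq_intros)
        then show ?thesis
          using Im_mult_of_real_divide[of "T t" "2 * x" "?w t"] by (simp only: Im_mult_of_real_divide)
      qed
      moreover have "\<forall>\<^sub>F y in nhds x. y < norm (?w t)"
        using eventually_nhds_in_open[of "{..<norm (?w t)}" x] gt by simp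
      then have "\<forall>\<^sub>F y in nhds x. f y t = Im (T t * (of_real (y\<^sup>2) / ?w t))"
        by eventually_elim (simp only: f_def disk_kernel_outside)
      ultimately show ?thesis
        using True by (simp add: g_def has_field_derivative_cong_eventually DERIV_cong_ev)
    next
      case False
      then have lt: "norm (?w t) < x" using cr t by (auto simp: crossing_def N_def)
      have "\<forall>\<^sub>F y in nhds x. f y t = Im (T t * cnj (?w t))"
        using order_tendstoD(1)[OF tendsto_ident_at lt, of UNIV] lt
        by (auto simp: eventually_nhds_conv_at f_def disk_kernel_def elim!: eventually_mono)
      moreover have "g t = 0" using False unfolding g_def by (rule if_not_P)
      ultimately show ?thesis by (simp add: DERIV_cong_ev)
    qed
  qed (use \<open>x > 0\<close> in \<open>auto simp: N_def\<close>)
  moreover have "integral {s..s + L} g = 2 * (x * Im (integral {t1..t2} (\<lambda>t. T t / ?w t)))"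
  proof -
    have int: "(\<lambda>t. T t / ?w t) integrable_on {t1..t2}"
      using nz by (intro integrable_continuous_interval continuous_intros continuous_gamma continuous_T) auto
    have "integral {s..s + L} g = integral {t1..t2} (\<lambda>t. Im (T t * (2 * x / ?w t)))"
      unfolding g_def by (subst integral_restrict_Int) (use c in \<open>auto simp: Int_absorb2 intro!: arg_cong2[of _ _ _ _ integral]\<close>)
    also have "\<dots> = integral {t1..t2} (\<lambda>t. 2 * x * Im (T t / ?w t))"
      using Im_mult_of_real_divide[of _ "2 * x"] by simp
    also have "\<dots> = 2 * x * integral {t1..t2} (\<lambda>t. Im (T t / ?w t))" by simp
    also have "integral {t1..t2} (\<lambda>t. Im (T t / ?w t)) = Im (integral {t1..t2} (\<lambda>t. T t / ?w t))"
      using integral_linear[OF int bounded_linear_Im] by (simp add: o_def)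
    finally show ?thesis by simp
  qed
  ultimately have "((\<lambda>y. integral {s..s + L} (f y) / 2) has_real_derivative x * Im (integral {t1..t2} (\<lambda>t. T t / ?w t))) (at x)"
    by (auto intro!: derivative_eq_intros)
  moreover have "\<forall>\<^sub>F y in nhds x. integral {s..s + L} (f y) / 2 = area_fun (L, \<gamma>) s y"
    using eventually_nhds_in_open[of "{0<..}" x] \<open>x > 0\<close>
    by (auto elim!: eventually_mono simp: integral_unique[OF fI])
  ultimately show ?thesis by (simp add: DERIV_cong_ev)
qed

lemma gamma_Lipschitz: "norm (\<gamma> t - \<gamma> s) \<le> \<bar>t - s\<bar>"
proof -
  have "norm (\<gamma> t - \<gamma> s) \<le> 1 * norm (t - s)"
  proof (rule differentiable_bound[where S=UNIV and f'="\<lambda>x h. h *\<^sub>R T x"])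
    show "onorm (\<lambda>h. h *\<^sub>R T x) \<le> 1" for x
      by (rule onorm_le) (simp add: norm_T)
  qed (use deriv in \<open>auto simp: has_vector_derivative_def\<close>)
  then show ?thesis by simp
qed

text \<open>Differentiating the kernel in the centre gives integrands with explicit primitives: a
  multiple of \<gamma> inside the disk and of \<open>1 / (\<gamma> t - \<gamma> s)\<close> outside.
  At the crossings these primitives match by inversion in the circle, so only the chord between the
  two crossings survives.\<close>

lemma area_fun_deriv_arclength:
  assumes "s \<in> {0..L}" "x > 0" and cr: "crossing s x t1 t2"
  shows "((\<lambda>s. area_fun (L, \<gamma>) s x) has_real_derivative Im (T s * cnj (\<gamma> t1 - \<gamma> t2))) (at s)"
proof -
  let ?w = "\<lambda>t. \<gamma> t - \<gamma> s"
  define f where "f y t = Im (T t * disk_kernel x (\<gamma> t - \<gamma> y))" for y t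
  define G where "G t = (if t \<in> {t1..t2} then x\<^sup>2 * T s * (T t / (?w t)\<^sup>2) else - cnj (T s) * T t)" for t
  define N where "N = {s, t1, t2, s + L}"
  have c: "s < t1" "t1 < t2" "t2 < s + L" using cr by (auto simp: crossing_def)
  have nz: "?w t \<noteq> 0" if "t \<in> {t1..t2}" for t using gamma_neq[of s t] that c by auto
  \<comment> \<open>The window starts at the fixed s while the centre y moves, so the domain of
    integration does not vary with y.\<close>
  have fI: "(f y has_integral 2 * area_fun (L, \<gamma>) y x) {s..s + L}" for y
    unfolding f_def using area_fun_window[OF assms(1)] \<open>x > 0\<close> by simp
  have d\<gamma>: "((\<lambda>y. \<gamma> t - \<gamma> y) has_vector_derivative - T s) (at s)" for t
    using has_vector_derivative_diff[OF has_vector_derivative_const deriv, of "\<gamma> t" s] by simp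
  have lim: "((\<lambda>y. norm (\<gamma> t - \<gamma> y)) \<longlongrightarrow> norm (?w t)) (at s)" for t
    using has_vector_derivative_continuous[OF d\<gamma>[of t]] by (intro tendsto_norm) (simp add: isCont_def)
  have "((\<lambda>y. integral {s..s + L} (f y)) has_real_derivative integral {s..s + L} (\<lambda>t. Im (G t))) (at s)"
  proof (rule has_real_derivative_integral_Lipschitz[where e=1 and B=1 and N=N])
    show "f y integrable_on {s..s + L}" for y
      using fI[of y] by (auto simp: integrable_on_def)
    show "\<bar>f y t - f s t\<bar> \<le> 1 * \<bar>y - s\<bar>" for y t
    proof -
      have "\<bar>f y t - f s t\<bar> = \<bar>Im (T t * (disk_kernel x (\<gamma> t - \<gamma> y) - disk_kernel x (?w t)))\<bar>"
        by (simp add: f_def algebra_simps)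
      also have "\<dots> \<le> norm (T t * (disk_kernel x (\<gamma> t - \<gamma> y) - disk_kernel x (?w t)))"
        by (rule abs_Im_le_cmod)
      also have "\<dots> \<le> norm ((\<gamma> t - \<gamma> y) - ?w t)"
        using disk_kernel_Lipschitz[OF \<open>x > 0\<close>, of "\<gamma> t - \<gamma> y" "?w t"] by (simp add: norm_mult norm_T)
      also have "\<dots> \<le> 1 * \<bar>y - s\<bar>"
        using gamma_Lipschitz[of s y] by (simp add: abs_minus_commute)
      finally show ?thesis .
    qed
    show "((\<lambda>y. f y t) has_real_derivative Im (G t)) (at s)" if t: "t \<in> {s..s + L} - N" for t
    proof (cases "t \<in> {t1..t2}")
      case True
      then have gt: "norm (?w t) > x" using cr t by (auto simp: crossing_def N_def)
      have "((\<lambda>w. of_real (x\<^sup>2) / w) has_field_derivative - of_real (x\<^sup>2) / (?w t)\<^sup>2) (at (?w t))"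
        using nz[OF True] by (auto intro!: derivative_eq_intros simp: power2_eq_square field_simps)
      from field_vector_diff_chain_at[OF d\<gamma> this]
      have "((\<lambda>y. T t * (of_real (x\<^sup>2) / (\<gamma> t - \<gamma> y))) has_vector_derivative T t * (- T s * (- of_real (x\<^sup>2) / (?w t)\<^sup>2))) (at s)"
        by (intro has_vector_derivative_mult_right) (simp add: o_def)
      from bounded_linear.has_vector_derivative[OF bounded_linear_Im this]
      have "((\<lambda>y. Im (T t * (of_real (x\<^sup>2) / (\<gamma> t - \<gamma> y)))) has_real_derivative Im (G t)) (at s)"
        using True by (simp add: G_def has_real_derivative_iff_has_vector_derivative mult_ac)
      moreover have "\<forall>\<^sub>F y in nhds s. x < norm (\<gamma> t - \<gamma> y)"
        using order_tendstoD(1)[OF lim gt] gt by (simp add: eventually_nhds_conv_at)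
      then have "\<forall>\<^sub>F y in nhds s. f y t = Im (T t * (of_real (x\<^sup>2) / (\<gamma> t - \<gamma> y)))"
        by eventually_elim (simp only: f_def disk_kernel_outside)
      ultimately show ?thesis by (simp add: DERIV_cong_ev)
    next
      case False
      then have lt: "norm (?w t) < x" using cr t by (auto simp: crossing_def N_def)
      from bounded_linear.has_vector_derivative[OF bounded_linear_cnj d\<gamma>[of t]]
      have "((\<lambda>y. T t * cnj (\<gamma> t - \<gamma> y)) has_vector_derivative T t * cnj (- T s)) (at s)"
        by (rule has_vector_derivative_mult_right)
      from bounded_linear.has_vector_derivative[OF bounded_linear_Im this]
      have "((\<lambda>y. Im (T t * cnj (\<gamma> t - \<gamma> y))) has_real_derivative Im (G t)) (at s)"
        using False by (auto simp: G_def has_real_derivative_iff_has_vector_derivative mult_ac)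
      moreover have "\<forall>\<^sub>F y in nhds s. f y t = Im (T t * cnj (\<gamma> t - \<gamma> y))"
        using order_tendstoD(2)[OF lim lt] lt
        by (auto simp: eventually_nhds_conv_at f_def disk_kernel_def elim!: eventually_mono)
      ultimately show ?thesis by (simp add: DERIV_cong_ev)
    qed
  qed (auto simp: N_def)
  moreover have "integral {s..s + L} (\<lambda>t. Im (G t)) = 2 * Im (T s * cnj (\<gamma> t1 - \<gamma> t2))"
  proof -
    have neq: "?w t1 \<noteq> 0" "?w t2 \<noteq> 0" using nz c by auto
    have "(T has_integral \<gamma> t1 - \<gamma> s) {s..t1}"
      using c deriv by (intro fundamental_theorem_of_calculus) (auto intro: has_vector_derivative_at_within)
    from has_integral_mult_right[OF this]
    have "((\<lambda>t. - cnj (T s) * T t) has_integral - cnj (T s) * (\<gamma> t1 - \<gamma> s)) {s..t1}" .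
    then have 1: "(G has_integral - cnj (T s) * (\<gamma> t1 - \<gamma> s)) {s..t1}"
      by (rule has_integral_spike_finite[of N, rotated 2]) (use c in \<open>auto simp: G_def N_def\<close>)
    have "(T has_integral \<gamma> (s + L) - \<gamma> t2) {t2..s + L}"
      using c deriv by (intro fundamental_theorem_of_calculus) (auto intro: has_vector_derivative_at_within)
    from has_integral_mult_right[OF this]
    have "((\<lambda>t. - cnj (T s) * T t) has_integral - cnj (T s) * (\<gamma> s - \<gamma> t2)) {t2..s + L}"
      by (simp only: periodic)
    then have 3: "(G has_integral - cnj (T s) * (\<gamma> s - \<gamma> t2)) {t2..s + L}"
      by (rule has_integral_spike_finite[of N, rotated 2]) (use c in \<open>auto simp: G_def N_def\<close>)
    have "((\<lambda>t. T t / (?w t)\<^sup>2) has_integral - (1 / ?w t2) - - (1 / ?w t1)) {t1..t2}"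
    proof (rule fundamental_theorem_of_calculus)
      fix t assume t: "t \<in> {t1..t2}"
      have d1: "((\<lambda>w. - (1 / w)) has_field_derivative 1 / (?w t)\<^sup>2) (at (?w t))"
        using nz[OF t] by (auto intro!: derivative_eq_intros simp: power2_eq_square field_simps)
      have "(?w has_vector_derivative T t) (at t)"
        using has_vector_derivative_diff[OF deriv[of t] has_vector_derivative_const[of "\<gamma> s"]] by simp
      from field_vector_diff_chain_at[OF this d1]
      have "((\<lambda>t. - (1 / ?w t)) has_vector_derivative T t * (1 / (?w t)\<^sup>2)) (at t)"
        by (simp add: o_def)
      then show "((\<lambda>t. - (1 / ?w t)) has_vector_derivative T t / (?w t)\<^sup>2) (at t within {t1..t2})"
        by (simp add: has_vector_derivative_at_within)
    qed (use c in auto)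
    from has_integral_mult_right[OF this, of "x\<^sup>2 * T s"]
    have "((\<lambda>t. x\<^sup>2 * T s * (T t / (?w t)\<^sup>2)) has_integral x\<^sup>2 * T s * (- (1 / ?w t2) - - (1 / ?w t1))) {t1..t2}" .
    then have 2: "(G has_integral x\<^sup>2 * T s * (- (1 / ?w t2) - - (1 / ?w t1))) {t1..t2}"
      by (rule has_integral_eq[rotated]) (auto simp: G_def)
    \<comment> \<open>On the circle inversion is the identity, which turns the boundary terms of the
      outer arc into conjugated chords and lets them combine with the inner ones.\<close>
    have inv: "of_real (x\<^sup>2) / ?w t1 = cnj (?w t1)" "of_real (x\<^sup>2) / ?w t2 = cnj (?w t2)"
    proof -
      have n: "norm (?w t1) = x" "norm (?w t2) = x" using cr unfolding crossing_def by blast+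
      show "of_real (x\<^sup>2) / ?w t1 = cnj (?w t1)" by (rule of_real_square_divide[OF neq(1) n(1)])
      show "of_real (x\<^sup>2) / ?w t2 = cnj (?w t2)" by (rule of_real_square_divide[OF neq(2) n(2)])
    qed
    have "(G has_integral (- cnj (T s) * (\<gamma> t1 - \<gamma> s) + x\<^sup>2 * T s * (- (1 / ?w t2) - - (1 / ?w t1)))
        + - cnj (T s) * (\<gamma> s - \<gamma> t2)) {s..s + L}"
      by (rule has_integral_combine[OF _ _ has_integral_combine[OF _ _ 1 2] 3]) (use c in auto)
    also have "x\<^sup>2 * T s * (- (1 / ?w t2) - - (1 / ?w t1)) = T s * (of_real (x\<^sup>2) / ?w t1 - of_real (x\<^sup>2) / ?w t2)"
      by (simp add: algebra_simps)
    also have "(- cnj (T s) * (\<gamma> t1 - \<gamma> s) + T s * (of_real (x\<^sup>2) / ?w t1 - of_real (x\<^sup>2) / ?w t2))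
        + - cnj (T s) * (\<gamma> s - \<gamma> t2) = T s * cnj (\<gamma> t1 - \<gamma> t2) - cnj (T s * cnj (\<gamma> t1 - \<gamma> t2))"
      unfolding inv by (simp add: algebra_simps)
    finally have "(G has_integral T s * cnj (\<gamma> t1 - \<gamma> t2) - cnj (T s * cnj (\<gamma> t1 - \<gamma> t2))) {s..s + L}" .
    from has_integral_linear[OF this bounded_linear_Im]
    have "((\<lambda>t. Im (G t)) has_integral Im (T s * cnj (\<gamma> t1 - \<gamma> t2) - cnj (T s * cnj (\<gamma> t1 - \<gamma> t2)))) {s..s + L}"
      by (simp only: o_def)
    moreover have "Im (z - cnj z) = 2 * Im z" for z by simp
    ultimately show ?thesis by (simp only: integral_unique)
  qed
  ultimately have "((\<lambda>y. integral {s..s + L} (f y) / 2) has_real_derivative Im (T s * cnj (\<gamma> t1 - \<gamma> t2))) (at s)"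
    by (auto intro!: derivative_eq_intros)
  moreover have "(\<lambda>y. integral {s..s + L} (f y) / 2) = (\<lambda>y. area_fun (L, \<gamma>) y x)"
    by (simp add: integral_unique[OF fI])
  ultimately show ?thesis by simp
qed

end

section \<open>Uniqueness of iterated partial derivatives\<close>

lemma has_partial_singleton:
  "has_partial g [Var_s] s r d \<longleftrightarrow> ((\<lambda>s. g s r) has_real_derivative d) (at s)"
  "has_partial g [Var_r] s r d \<longleftrightarrow> (g s has_real_derivative d) (at r)"
proof -
  have "(\<exists>h. (\<forall>\<^sub>F x in nhds s. g x r = h x) \<and> (h has_real_derivative d) (at s))
      \<longleftrightarrow> ((\<lambda>s. g s r) has_real_derivative d) (at s)"
    by (auto simp: DERIV_cong_ev[OF refl _ refl] intro!: exI[of _ "\<lambda>s. g s r"])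
  then show "has_partial g [Var_s] s r d \<longleftrightarrow> ((\<lambda>s. g s r) has_real_derivative d) (at s)" by simp
  have "(\<exists>h. (\<forall>\<^sub>F x in nhds r. g s x = h x) \<and> (h has_real_derivative d) (at r))
      \<longleftrightarrow> (g s has_real_derivative d) (at r)"
    by (auto simp: DERIV_cong_ev[OF refl _ refl] intro!: exI[of _ "g s"])
  then show "has_partial g [Var_r] s r d \<longleftrightarrow> (g s has_real_derivative d) (at r)" by simp
qed

lemma has_partial_unique:
  assumes "has_partial g vs s r d" "has_partial g vs s r d'"
  shows "d = d'"
  using assms
proof (induction vs arbitrary: s r d d')
  case (Cons v vs)
  show ?case
  proof (cases v)
    case Var_s
    with Cons.prems obtain h h' where
      h: "\<forall>\<^sub>F x in nhds s. has_partial g vs x r (h x)" "(h has_real_derivative d) (at s)"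
        "\<forall>\<^sub>F x in nhds s. has_partial g vs x r (h' x)" "(h' has_real_derivative d') (at s)" by auto
    have "\<forall>\<^sub>F x in nhds s. h x = h' x"
      using h(1) h(3) by eventually_elim (rule Cons.IH)
    then show ?thesis using h(2,4) DERIV_cong_ev[OF refl _ refl] DERIV_unique by blast
  next
    case Var_r
    with Cons.prems obtain h h' where
      h: "\<forall>\<^sub>F x in nhds r. has_partial g vs s x (h x)" "(h has_real_derivative d) (at r)"
        "\<forall>\<^sub>F x in nhds r. has_partial g vs s x (h' x)" "(h' has_real_derivative d') (at r)" by auto
    have "\<forall>\<^sub>F x in nhds r. h x = h' x"
      using h(1) h(3) by eventually_elim (rule Cons.IH)
    then show ?thesis using h(2,4) DERIV_cong_ev[OF refl _ refl] DERIV_unique by blast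
  qed
qed simp

lemma same_data_eq:
  assumes "same_data r c c'" "length vs \<in> {1, 2, 3}" "s \<in> {0..fst c}"
    and "has_partial (area_fun c) vs s r d" "has_partial (area_fun c') vs s r d'"
  shows "d = d'"
  using assms has_partial_unique unfolding same_data_def by blast

section \<open>The angle between the crossings and the second radial derivative\<close>

context ccw_loop
begin

text \<open>The exponential of the logarithmic integral is the quotient of the chords at its ends.
  These have equal length, so the real part vanishes and the imaginary part is an angle from the
  first chord to the second.\<close>

lemma exp_integral_crossing:
  assumes cr: "crossing s x t1 t2" and "x > 0"
  shows "cis (Im (integral {t1..t2} (\<lambda>t. T t / (\<gamma> t - \<gamma> s)))) = (\<gamma> t2 - \<gamma> s) / (\<gamma> t1 - \<gamma> s)"
proof -
  let ?A = "integral {t1..t2} (\<lambda>t. T t / (\<gamma> t - \<gamma> s))"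
  have c: "s < t1" "t1 < t2" "t2 < s + L" "norm (\<gamma> t1 - \<gamma> s) = x" "norm (\<gamma> t2 - \<gamma> s) = x"
    using cr by (auto simp: crossing_def)
  have "\<gamma> C1_differentiable_on {t1..t2}"
    unfolding C1_differentiable_on_def using deriv continuous_T by blast
  then have pc: "\<gamma> piecewise_C1_differentiable_on {t1..t2}"
    by (rule C1_differentiable_imp_piecewise)
  have "\<gamma> t \<noteq> \<gamma> s" if "t \<in> {t1..t2}" for t using gamma_neq[of s t] c that by auto
  then have "\<gamma> s \<notin> \<gamma> ` {t1..t2}" unfolding image_iff by metis
  from winding_number_exp_integral(2)[OF pc _ this]
  have "exp (- ?A) * (\<gamma> t2 - \<gamma> s) = \<gamma> t1 - \<gamma> s"
    using c by (simp add: vector_derivative_at[OF deriv])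
  then have "exp ?A * (exp (- ?A) * (\<gamma> t2 - \<gamma> s)) = exp ?A * (\<gamma> t1 - \<gamma> s)" by simp
  then have e: "\<gamma> t2 - \<gamma> s = exp ?A * (\<gamma> t1 - \<gamma> s)"
    by (simp only: mult.assoc[symmetric] exp_minus_inverse mult_1_left)
  then have "x = exp (Re ?A) * x" using c by (metis norm_exp_eq_Re norm_mult)
  then have "Re ?A = 0" using \<open>x > 0\<close> by simp
  then have "exp ?A = cis (Im ?A)" by (simp add: exp_eq_polar)
  moreover have "\<gamma> t1 - \<gamma> s \<noteq> 0" using c \<open>x > 0\<close> by auto
  ultimately show ?thesis using e by simp
qed

text \<open>The product rule gives the angle itself plus the effect of the moving endpoints, whose
  speed is x divided by the radial component of the tangent. Since x^2 / w is the conjugate of w on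
  the circle, the factors x are absorbed, and each endpoint contributes the tangent of the angle
  between curve and radius.\<close>

lemma area_fun_deriv2_radius:
  assumes s: "s \<in> {0..L}" and "x > 0" and cr: "crossing s x t1 t2"
    and nz: "\<And>t. t \<in> {s<..<s + L} \<Longrightarrow> norm (\<gamma> t - \<gamma> s) \<le> x \<Longrightarrow> (\<gamma> t - \<gamma> s) \<bullet> T t \<noteq> 0"
  shows "has_partial (area_fun (L, \<gamma>)) [Var_r, Var_r] s x
    (Im (integral {t1..t2} (\<lambda>t. T t / (\<gamma> t - \<gamma> s)))
      + (Im (T t2 * cnj (\<gamma> t2 - \<gamma> s)) / ((\<gamma> t2 - \<gamma> s) \<bullet> T t2)
       - Im (T t1 * cnj (\<gamma> t1 - \<gamma> s)) / ((\<gamma> t1 - \<gamma> s) \<bullet> T t1)))"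
proof -
  let ?K = "\<lambda>t. T t / (\<gamma> t - \<gamma> s)"
  have c: "s < t1" "t1 < t2" "t2 < s + L" and n: "norm (\<gamma> t1 - \<gamma> s) = x" "norm (\<gamma> t2 - \<gamma> s) = x"
    using cr by (auto simp: crossing_def)
  obtain R where R: "R > x" "\<And>t. t \<in> {s<..<s + L} \<Longrightarrow> norm (\<gamma> t - \<gamma> s) \<le> R \<Longrightarrow> (\<gamma> t - \<gamma> s) \<bullet> T t \<noteq> 0"
    using crossing_extend[OF cr \<open>x > 0\<close> nz] by blast
  \<comment> \<open>The choice of crossings is forced to be (t1, t2) at y = x, so that the
    derivative refers to the given pair.\<close>
  have "\<exists>p. (y \<in> {0<..<R} \<longrightarrow> crossing s y (fst p) (snd p)) \<and> (y = x \<longrightarrow> p = (t1, t2))" for y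
  proof (cases "y \<in> {0<..<R} \<and> y \<noteq> x")
    case True
    then obtain u v where "crossing s y u v"
      using ex_crossing[of y s] R(2) by (metis greaterThanLessThan_iff less_imp_le order_trans)
    then show ?thesis using True by (intro exI[of _ "(u, v)"]) auto
  qed (use cr in \<open>auto intro!: exI[of _ "(t1, t2)"]\<close>)
  then obtain p where p: "\<And>y. y \<in> {0<..<R} \<Longrightarrow> crossing s y (fst (p y)) (snd (p y))" "p x = (t1, t2)"
    by metis
  define \<tau> where "\<tau> y = fst (p y)" for y
  define \<sigma> where "\<sigma> y = snd (p y)" for y
  have px: "\<tau> x = t1" "\<sigma> x = t2" by (auto simp: \<tau>_def \<sigma>_def p)
  have near: "\<forall>\<^sub>F y in nhds x. y \<in> {0<..<R}"
    using R \<open>x > 0\<close> by (intro eventually_nhds_in_open) auto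
  then have ev: "\<forall>\<^sub>F y in nhds x. crossing s y (\<tau> y) (\<sigma> y)"
    by eventually_elim (auto simp: \<tau>_def \<sigma>_def p)
  have ev2: "\<forall>\<^sub>F y in nhds x. has_partial (area_fun (L, \<gamma>)) [Var_r] s y (y * Im (integral {\<tau> y..\<sigma> y} ?K))"
    using near ev unfolding has_partial_singleton
    by eventually_elim (use s in \<open>auto intro!: area_fun_deriv_radius\<close>)
  note d = crossing_has_real_derivative[OF DERIV_const[of s] DERIV_ident ev, unfolded px, simplified]
  \<comment> \<open>The midpoints leave room for the crossings to move and keep the interval away
    from s and \<open>s + L\<close>, where the integrand is singular. A primitive based at a then
    handles both moving ends.\<close>
  define a where "a = (s + t1) / 2"
  define b where "b = (t2 + (s + L)) / 2"
  have ab: "s < a" "a < t1" "t2 < b" "b < s + L" using c by (auto simp: a_def b_def)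
  have contK: "continuous_on {a..b} ?K"
  proof (intro continuous_intros continuous_gamma continuous_T ballI)
    show "\<gamma> u - \<gamma> s \<noteq> 0" if "u \<in> {a..b}" for u using gamma_neq[of s u] ab that by auto
  qed
  define G where "G u = integral {a..u} ?K" for u
  have G: "(G has_vector_derivative ?K u) (at u)" if "u \<in> {a<..<b}" for u
  proof -
    have "(G has_vector_derivative ?K u) (at u within {a..b})"
      unfolding G_def by (rule integral_has_vector_derivative[OF contK]) (use that in auto)
    then show ?thesis using that by (simp add: at_within_Icc_at)
  qed
  have chain: "((\<lambda>y. Im (G (q y))) has_real_derivative Im (?K (q x)) * q') (at x)"
    if "(q has_real_derivative q') (at x)" "q x \<in> {a<..<b}" for q q'
  proof -
    have "(q has_vector_derivative q') (at x)"
      using that by (simp add: has_real_derivative_iff_has_vector_derivative)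
    from vector_diff_chain_at[OF this G[OF that(2)]]
    have "((\<lambda>y. G (q y)) has_vector_derivative q' *\<^sub>R ?K (q x)) (at x)" by (simp add: o_def)
    from bounded_linear.has_vector_derivative[OF bounded_linear_Im this]
    show ?thesis by (simp add: has_real_derivative_iff_has_vector_derivative mult.commute)
  qed
  define \<tau>' where "\<tau>' = x / ((\<gamma> t1 - \<gamma> s) \<bullet> T t1)"
  define \<sigma>' where "\<sigma>' = x / ((\<gamma> t2 - \<gamma> s) \<bullet> T t2)"
  have dG: "((\<lambda>y. y * (Im (G (\<sigma> y)) - Im (G (\<tau> y)))) has_real_derivative
      (Im (G t2) - Im (G t1)) + x * (Im (?K t2) * \<sigma>' - Im (?K t1) * \<tau>')) (at x)"
  proof -
    have 1: "((\<lambda>y. Im (G (\<tau> y))) has_real_derivative Im (?K t1) * \<tau>') (at x)"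
      using chain[of \<tau> \<tau>'] d(1) ab c by (simp add: px \<tau>'_def)
    have 2: "((\<lambda>y. Im (G (\<sigma> y))) has_real_derivative Im (?K t2) * \<sigma>') (at x)"
      using chain[of \<sigma> \<sigma>'] d(2) ab c by (simp add: px \<sigma>'_def)
    show ?thesis
      using DERIV_mult[OF DERIV_ident DERIV_diff[OF 2 1]] by (simp add: px mult.commute)
  qed
  have GG: "Im (integral {u..v} ?K) = Im (G v) - Im (G u)" if "a \<le> u" "u \<le> v" "v \<le> b" for u v
  proof -
    have "?K integrable_on {a..v}"
      using contK that by (intro integrable_continuous_interval) (auto intro: continuous_on_subset)
    from Henstock_Kurzweil_Integration.integral_combine[OF that(1,2) this]
    have "integral {u..v} ?K = G v - G u" by (simp add: G_def algebra_simps)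
    then show ?thesis by simp
  qed
  have ev3: "\<forall>\<^sub>F y in nhds x. y * Im (integral {\<tau> y..\<sigma> y} ?K) = y * (Im (G (\<sigma> y)) - Im (G (\<tau> y)))"
  proof -
    have "\<forall>\<^sub>F y in nhds x. a < \<tau> y" "\<forall>\<^sub>F y in nhds x. \<sigma> y < b"
      using DERIV_isCont[OF d(1)] DERIV_isCont[OF d(2)] ab px
      unfolding isCont_def tendsto_at_iff_tendsto_nhds by (auto intro: order_tendstoD)
    then show ?thesis using ev
      by eventually_elim (auto simp: GG crossing_def)
  qed
  have val: "(Im (G t2) - Im (G t1)) + x * (Im (?K t2) * \<sigma>' - Im (?K t1) * \<tau>') =
     Im (integral {t1..t2} ?K)
      + (Im (T t2 * cnj (\<gamma> t2 - \<gamma> s)) / ((\<gamma> t2 - \<gamma> s) \<bullet> T t2)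
       - Im (T t1 * cnj (\<gamma> t1 - \<gamma> s)) / ((\<gamma> t1 - \<gamma> s) \<bullet> T t1))"
  proof -
    have "Im (T t * cnj (\<gamma> t - \<gamma> s)) = x\<^sup>2 * Im (?K t)" if "norm (\<gamma> t - \<gamma> s) = x" for t
    proof -
      have "\<gamma> t - \<gamma> s \<noteq> 0" using that \<open>x > 0\<close> by auto
      from of_real_square_divide[OF this that] show ?thesis
        by (simp only: Im_mult_of_real_divide[symmetric])
    qed
    then show ?thesis
      using n GG[of t1 t2] ab c by (simp add: \<tau>'_def \<sigma>'_def power2_eq_square algebra_simps)
  qed
  have D: "((\<lambda>y. y * Im (integral {\<tau> y..\<sigma> y} ?K)) has_real_derivative
     Im (integral {t1..t2} ?K)
      + (Im (T t2 * cnj (\<gamma> t2 - \<gamma> s)) / ((\<gamma> t2 - \<gamma> s) \<bullet> T t2)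
       - Im (T t1 * cnj (\<gamma> t1 - \<gamma> s)) / ((\<gamma> t1 - \<gamma> s) \<bullet> T t1))) (at x)"
    using dG unfolding val by (subst DERIV_cong_ev[OF refl ev3 refl])
  show ?thesis
    unfolding has_partial.simps(2)[of _ _ "[Var_r]"] variable.case
    by (rule exI, rule conjI[OF ev2 D])
qed

end

section \<open>Recovering the frame and the curvature\<close>

text \<open>The chord condition is the form in which the graph condition enters. With the tangent at
  the centre it fixes the signs of the tangential components; with the roles of s and t exchanged it
  makes the crossings transversal.\<close>

locale chord_loop = ccw_loop +
  fixes r :: real
  assumes r_pos: "r > 0"
    and chord: "\<gamma> t \<noteq> \<gamma> s \<Longrightarrow> norm (\<gamma> t - \<gamma> s) \<le> r \<Longrightarrow> (\<gamma> t - \<gamma> s) \<bullet> T s \<noteq> 0"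
begin

lemma chord_far:
  assumes "t \<in> {s<..<s + L}" "norm (\<gamma> t - \<gamma> s) \<le> r"
  shows "(\<gamma> t - \<gamma> s) \<bullet> T t \<noteq> 0"
proof -
  have "\<gamma> s \<noteq> \<gamma> t" using gamma_neq[of s t] assms by auto
  from chord[OF this] assms(2) have "(\<gamma> s - \<gamma> t) \<bullet> T t \<noteq> 0" by (simp add: norm_minus_commute)
  then show ?thesis by (simp add: inner_diff_left)
qed

lemma chord_near:
  assumes "t \<in> {s<..<s + L}" "norm (\<gamma> t - \<gamma> s) \<le> r"
  shows "(\<gamma> t - \<gamma> s) \<bullet> T s \<noteq> 0"
  using gamma_neq[of s t] assms by (intro chord) auto

lemma ex_crossing_functions: "\<exists>\<tau> \<sigma>. \<forall>s. crossing s r (\<tau> s) (\<sigma> s)"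
proof -
  have "\<exists>t1 t2. crossing s r t1 t2" for s
    using ex_crossing[OF r_pos chord_far, of s] by blast
  then show ?thesis by metis
qed

text \<open>At the two crossings these are the numbers a1 and a2 of the overview: dividing by
  \<open>T s\<close> turns the tangent at s onto the positive real axis. The slopes defined next are
  the corresponding m1 and m2.\<close>

definition direction :: "real \<Rightarrow> real \<Rightarrow> complex" where
  "direction s t = (\<gamma> t - \<gamma> s) / (of_real r * T s)"

definition slope :: "real \<Rightarrow> real \<Rightarrow> real" where
  "slope s t = Im (T t * cnj (\<gamma> t - \<gamma> s)) / ((\<gamma> t - \<gamma> s) \<bullet> T t)"

definition curvature :: "real \<Rightarrow> real" where
  "curvature s = Im (T' s * cnj (T s))"

lemma T_nz: "T s \<noteq> 0" using norm_T[of s] by auto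

lemma T_cnj: "T s * cnj (T s) = 1"
  using complex_norm_square[of "T s"] by (simp add: norm_T)

lemma gamma_diff_eq: "\<gamma> t - \<gamma> s = of_real r * direction s t * T s"
  using r_pos T_nz[of s] by (simp add: direction_def)

lemma direction_eq: "direction s t = (\<gamma> t - \<gamma> s) * cnj (T s) / r"
proof -
  have "inverse (T s) = cnj (T s)" using T_cnj by (metis inverse_unique)
  then show ?thesis by (simp add: direction_def divide_inverse mult_ac)
qed

lemma scaled_direction: "of_real r * direction s t = (\<gamma> t - \<gamma> s) * cnj (T s)"
  using r_pos by (simp add: direction_eq)

lemma norm_direction: "norm (\<gamma> t - \<gamma> s) = r \<Longrightarrow> norm (direction s t) = 1"
  using r_pos by (simp add: direction_def norm_mult norm_divide norm_T)

lemma inner_eq_Re_direction: "(\<gamma> t - \<gamma> s) \<bullet> T s = r * Re (direction s t)"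
  using arg_cong[OF scaled_direction[of s t], of Re] by (simp add: inner_complex_def algebra_simps)

lemma Re_T'_cnj_T: "Re (T' s * cnj (T s)) = 0"
proof -
  have "((\<lambda>s. T s \<bullet> T s) has_derivative (\<lambda>h. T s \<bullet> (h *\<^sub>R T' s) + (h *\<^sub>R T' s) \<bullet> T s)) (at s)"
    using deriv2[of s] unfolding has_vector_derivative_def by (auto intro!: derivative_eq_intros)
  moreover have "(\<lambda>s. T s \<bullet> T s) = (\<lambda>s. 1)" using norm_T by (simp add: fun_eq_iff norm_eq_1)
  ultimately have "((\<lambda>s. 1::real) has_derivative (\<lambda>h. T s \<bullet> (h *\<^sub>R T' s) + (h *\<^sub>R T' s) \<bullet> T s)) (at s)" by simp
  from has_derivative_unique[OF this has_derivative_const]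
  have "T s \<bullet> T' s = 0" by (auto simp: fun_eq_iff inner_commute dest: spec[of _ 1])
  then show ?thesis by (simp add: inner_complex_def mult.commute)
qed

lemma T'_eq: "T' s = \<i> * curvature s * T s"
proof -
  have "T' s * cnj (T s) = \<i> * curvature s"
    using Re_T'_cnj_T[of s] by (simp add: complex_eq_iff curvature_def)
  then have "T' s * (T s * cnj (T s)) = \<i> * curvature s * T s" by (simp add: mult_ac)
  then show ?thesis by (simp add: T_cnj)
qed

text \<open>The turning rate of the direction has three sources. The frame turns at rate \<kappa>,
  which is subtracted; the motion of the centre adds \<open>Im a / r\<close>; and the crossing
  slides along the curve, which adds the slope times \<open>Re a / r\<close>.\<close>

lemma direction_derivative:
  assumes d: "(\<tau> has_real_derivative ((\<gamma> (\<tau> s) - \<gamma> s) \<bullet> T s) / ((\<gamma> (\<tau> s) - \<gamma> s) \<bullet> T (\<tau> s))) (at s)"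
    and n: "norm (\<gamma> (\<tau> s) - \<gamma> s) = r" and nz: "(\<gamma> (\<tau> s) - \<gamma> s) \<bullet> T (\<tau> s) \<noteq> 0"
  obtains D where "((\<lambda>u. direction u (\<tau> u)) has_vector_derivative D) (at s)"
    "Im (D * cnj (direction s (\<tau> s))) =
      (slope s (\<tau> s) * Re (direction s (\<tau> s)) + Im (direction s (\<tau> s))) / r - curvature s"
proof -
  define w where "w = \<gamma> (\<tau> s) - \<gamma> s"
  define a where "a = direction s (\<tau> s)"
  define \<tau>' where "\<tau>' = (w \<bullet> T s) / (w \<bullet> T (\<tau> s))"
  have "(\<tau> has_vector_derivative \<tau>') (at s)"
    using d by (simp add: \<tau>'_def w_def has_real_derivative_iff_has_vector_derivative)
  from vector_diff_chain_at[OF this deriv]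
  have "((\<lambda>u. \<gamma> (\<tau> u) - \<gamma> u) has_vector_derivative (\<tau>' *\<^sub>R T (\<tau> s) - T s)) (at s)"
    by (intro has_vector_derivative_diff deriv) (simp add: o_def)
  from has_vector_derivative_mult[OF this bounded_linear.has_vector_derivative[OF bounded_linear_cnj deriv2]]
  have "((\<lambda>u. (\<gamma> (\<tau> u) - \<gamma> u) * cnj (T u)) has_vector_derivative
      (w * cnj (T' s) + (\<tau>' *\<^sub>R T (\<tau> s) - T s) * cnj (T s))) (at s)"
    by (simp add: w_def)
  from has_vector_derivative_mult_right[OF this, of "1 / of_real r"]
  have 1: "((\<lambda>u. direction u (\<tau> u)) has_vector_derivative
      (w * cnj (T' s) + (\<tau>' *\<^sub>R T (\<tau> s) - T s) * cnj (T s)) / of_real r) (at s)"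
    by (simp add: direction_eq)
  have wa: "w = of_real r * a * T s" by (simp add: w_def a_def gamma_diff_eq)
  have cw: "cnj w = of_real r * cnj a * cnj (T s)" by (simp add: wa)
  have aa: "a * cnj a = 1"
    using norm_direction[OF n] complex_norm_square[of a] by (simp add: a_def)
  have "(w * cnj (T' s) + (\<tau>' *\<^sub>R T (\<tau> s) - T s) * cnj (T s)) / of_real r * cnj a
     = - \<i> * curvature s * (a * cnj a) * (T s * cnj (T s))
       + (of_real \<tau>' * T (\<tau> s) * cnj w - cnj a * of_real r * (T s * cnj (T s))) / (of_real r)\<^sup>2"
    unfolding T'_eq[of s] cw using r_pos
    by (simp add: wa scaleR_conv_of_real power2_eq_square field_simps)
  also have "\<dots> = - \<i> * curvature s + (of_real \<tau>' * (T (\<tau> s) * cnj w) - of_real r * cnj a) / of_real (r\<^sup>2)"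
    by (simp add: aa T_cnj mult_ac)
  finally have "Im ((w * cnj (T' s) + (\<tau>' *\<^sub>R T (\<tau> s) - T s) * cnj (T s)) / of_real r * cnj a)
    = - curvature s + (\<tau>' * Im (T (\<tau> s) * cnj w) + r * Im a) / r\<^sup>2"
    by (simp only:) (simp add: Im_divide_of_real del: of_real_power)
  also have "\<tau>' * Im (T (\<tau> s) * cnj w) = (w \<bullet> T s) * slope s (\<tau> s)"
    by (simp add: \<tau>'_def slope_def w_def)
  also have "w \<bullet> T s = r * Re a" by (simp add: w_def a_def inner_eq_Re_direction)
  also have "- curvature s + (r * Re a * slope s (\<tau> s) + r * Im a) / r\<^sup>2
      = (slope s (\<tau> s) * Re a + Im a) / r - curvature s"
    using r_pos by (simp add: power2_eq_square field_simps)
  finally show thesis using that[OF 1] by (simp add: a_def)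
qed

text \<open>The same angle A enters both radial derivatives and the relation between the two
  directions. Subtracting it from the second radial derivative isolates the difference of the
  slopes.\<close>

lemma data_at:
  assumes s: "s \<in> {0..L}" and cr: "crossing s r t1 t2"
  obtains A where "has_partial (area_fun (L, \<gamma>)) [Var_r] s r (r * A)"
    "has_partial (area_fun (L, \<gamma>)) [Var_s] s r (r * Im (direction s t2 - direction s t1))"
    "has_partial (area_fun (L, \<gamma>)) [Var_r, Var_r] s r (A + (slope s t2 - slope s t1))"
    "direction s t2 = cis A * direction s t1"
    "norm (direction s t1) = 1" "norm (direction s t2) = 1"
    "Re (direction s t1) > 0" "Re (direction s t2) < 0"
proof -
  define A where "A = Im (integral {t1..t2} (\<lambda>t. T t / (\<gamma> t - \<gamma> s)))"
  have n: "norm (\<gamma> t1 - \<gamma> s) = r" "norm (\<gamma> t2 - \<gamma> s) = r" using cr by (auto simp: crossing_def)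
  have signs: "Re (direction s t1) > 0" "Re (direction s t2) < 0"
    using crossing_signs[OF cr chord_near] r_pos
    by (auto simp: inner_eq_Re_direction zero_less_mult_iff mult_less_0_iff)
  have "Im (T s * cnj (\<gamma> t1 - \<gamma> t2)) = r * Im (direction s t2 - direction s t1)"
    using arg_cong[OF scaled_direction[of s t1], of Im] arg_cong[OF scaled_direction[of s t2], of Im]
    by (simp add: algebra_simps)
  then have 2: "has_partial (area_fun (L, \<gamma>)) [Var_s] s r (r * Im (direction s t2 - direction s t1))"
    using area_fun_deriv_arclength[OF s r_pos cr] unfolding has_partial_singleton by simp
  have nz: "\<gamma> t1 - \<gamma> s \<noteq> 0" using n r_pos by auto
  have 4: "direction s t2 = cis A * direction s t1"
    unfolding A_def exp_integral_crossing[OF cr r_pos] using nz by (simp add: direction_def)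
  show thesis
  proof (rule that[OF _ 2 _ 4])
    show "has_partial (area_fun (L, \<gamma>)) [Var_r] s r (r * A)"
      using area_fun_deriv_radius[OF s r_pos cr] unfolding has_partial_singleton A_def .
    show "has_partial (area_fun (L, \<gamma>)) [Var_r, Var_r] s r (A + (slope s t2 - slope s t1))"
      using area_fun_deriv2_radius[OF s r_pos cr chord_far] unfolding A_def slope_def .
  qed (use signs n norm_direction in auto)
qed

end

text \<open>The chord from a to b has length \<open>norm (cis A - 1)\<close>, known from the angle.
  Length and imaginary part leave only the sign of its real part open, and that is prescribed.
  Dividing the chord by \<open>cis A - 1\<close>, nonzero because the chord is, recovers a.\<close>

lemma unit_pair_determined:
  fixes a b a' b' :: complex
  assumes "b = cis A * a" "b' = cis A * a'" "norm a = 1" "norm a' = 1"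
    and "Im (b - a) = Im (b' - a')" "Re (b - a) < 0" "Re (b' - a') < 0"
  shows "a = a'" "b = b'"
proof -
  have ba: "b - a = (cis A - 1) * a" "b' - a' = (cis A - 1) * a'"
    using assms by (auto simp: algebra_simps)
  then have "norm (b - a) = norm (b' - a')" using assms by (simp add: norm_mult)
  then have "(Re (b - a))\<^sup>2 = (Re (b' - a'))\<^sup>2"
    using assms(5) by (simp add: cmod_def)
  then have "Re (b - a) = Re (b' - a')"
    using assms by (simp add: power2_eq_iff)
  with assms(5) have eq: "b - a = b' - a'" by (simp add: complex_eq_iff)
  have "cis A - 1 \<noteq> 0"
  proof
    assume "cis A - 1 = 0"
    then have "b - a = 0" using ba(1) by simp
    then show False using assms(6) by (metis less_irrefl zero_complex.sel(1))
  qed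
  then show "a = a'" using eq ba by simp
  then show "b = b'" using eq by simp
qed

text \<open>The number d is the determinant of the frame; its square is 1 by the Lagrange identity.
  Cramer's rule then shows that a vector with both components 0 vanishes.\<close>

lemma complex_orthonormal_nonzero:
  fixes u v z :: complex
  assumes "norm u = 1" "norm v = 1" "u \<bullet> v = 0" "z \<noteq> 0" "z \<bullet> v = 0"
  shows "z \<bullet> u \<noteq> 0"
proof
  assume z: "z \<bullet> u = 0"
  define d where "d = Re u * Im v - Im u * Re v"
  have "d\<^sup>2 = ((Re u)\<^sup>2 + (Im u)\<^sup>2) * ((Re v)\<^sup>2 + (Im v)\<^sup>2) - (Re u * Re v + Im u * Im v)\<^sup>2"
    by (simp add: d_def power2_eq_square algebra_simps)
  also have "\<dots> = 1" using assms(1-3) by (simp add: inner_complex_def flip: cmod_power2)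
  finally have "d \<noteq> 0" by auto
  have "Re z * d = Im v * (z \<bullet> u) - Im u * (z \<bullet> v)" "Im z * d = Re u * (z \<bullet> v) - Re v * (z \<bullet> u)"
    by (auto simp: d_def inner_complex_def algebra_simps)
  with z assms(5) \<open>d \<noteq> 0\<close> have "Re z = 0" "Im z = 0" by auto
  with \<open>z \<noteq> 0\<close> show False by (simp add: complex_eq_iff)
qed

lemma (in loop) gamma_in_boundary: "\<gamma> s \<in> boundary (L, \<gamma>)"
proof -
  define k where "k = \<lfloor>s / L\<rfloor>"
  have "s + of_int (- k) * L \<in> {0..L}"
    using floor_divide_lower[OF L_pos, of s] floor_divide_upper[OF L_pos, of s]
    by (auto simp: k_def algebra_simps)
  then show ?thesis
    unfolding boundary_def prod.case by (rule image_eqI[rotated]) (simp only: periodic_int)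
qed

text \<open>Since f has derivative 0 at 0, the tangent is parallel to u. A chord orthogonal to the
  tangent then has horizontal coordinate 0, the same as the centre, and a graph has only one point
  above it.\<close>

lemma (in loop) TGL_at_imp_not_orthogonal:
  assumes tgl: "TGL_at (L, \<gamma>) (\<gamma> s) r" and "r > 0"
    and neq: "\<gamma> t \<noteq> \<gamma> s" and le: "norm (\<gamma> t - \<gamma> s) \<le> r"
  shows "(\<gamma> t - \<gamma> s) \<bullet> T s \<noteq> 0"
proof
  assume orth: "(\<gamma> t - \<gamma> s) \<bullet> T s = 0"
  from tgl obtain u v X f where uv: "norm u = 1" "norm v = 1" "u \<bullet> v = 0" and f: "f 0 = 0"
    "(f has_real_derivative 0) (at 0)"
    and graph: "boundary (L, \<gamma>) \<inter> cball (\<gamma> s) r = (\<lambda>x. \<gamma> s + x *\<^sub>R u + f x *\<^sub>R v) ` X"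
    unfolding TGL_at_def by blast
  have uu: "u \<bullet> u = 1" "v \<bullet> v = 1" "v \<bullet> u = 0" using uv by (auto simp: norm_eq_1 inner_commute)
  have rep: "\<gamma> t' - \<gamma> s = ((\<gamma> t' - \<gamma> s) \<bullet> u) *\<^sub>R u + f ((\<gamma> t' - \<gamma> s) \<bullet> u) *\<^sub>R v"
    if "norm (\<gamma> t' - \<gamma> s) \<le> r" for t'
  proof -
    have "\<gamma> t' \<in> boundary (L, \<gamma>) \<inter> cball (\<gamma> s) r"
      using gamma_in_boundary that by (simp add: dist_norm norm_minus_commute)
    then obtain x where "\<gamma> t' - \<gamma> s = x *\<^sub>R u + f x *\<^sub>R v" unfolding graph by force
    moreover from this have "(\<gamma> t' - \<gamma> s) \<bullet> u = x" by (simp add: inner_add_left uu)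
    ultimately show ?thesis by simp
  qed
  have "T s \<bullet> v = 0"
  proof -
    have "((\<lambda>t. norm (\<gamma> t - \<gamma> s)) \<longlongrightarrow> norm (\<gamma> s - \<gamma> s)) (nhds s)"
    proof -
      have "isCont (\<lambda>t. norm (\<gamma> t - \<gamma> s)) s"
        using continuous_on_dist[of UNIV "\<gamma> s"] by (simp add: continuous_on_eq_continuous_at)
      from isCont_tendsto_compose[OF this filterlim_ident] show ?thesis .
    qed
    \<comment> \<open>Parameters near s stay in the disk, so the graph equation holds on a
      neighbourhood and may be differentiated there.\<close>
    then have "\<forall>\<^sub>F t in nhds s. norm (\<gamma> t - \<gamma> s) < r"
      using \<open>r > 0\<close> by (auto intro: order_tendstoD)
    then have "\<forall>\<^sub>F t in nhds s. (\<gamma> t - \<gamma> s) \<bullet> v = f ((\<gamma> t - \<gamma> s) \<bullet> u)"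
    proof eventually_elim
      case (elim t)
      have "(\<gamma> t - \<gamma> s) \<bullet> v = (((\<gamma> t - \<gamma> s) \<bullet> u) *\<^sub>R u + f ((\<gamma> t - \<gamma> s) \<bullet> u) *\<^sub>R v) \<bullet> v"
        using rep[of t] elim by simp
      then show ?case by (simp add: inner_add_left uv(3) uu)
    qed
    moreover have "((\<lambda>t. f ((\<gamma> t - \<gamma> s) \<bullet> u)) has_real_derivative 0 * (T s \<bullet> u)) (at s)"
      by (rule DERIV_chain2[OF _ deriv_inner]) (simp add: f)
    ultimately have "((\<lambda>t. (\<gamma> t - \<gamma> s) \<bullet> v) has_real_derivative 0) (at s)"
      by (simp add: DERIV_cong_ev)
    then show ?thesis using DERIV_unique[OF deriv_inner] by blast
  qed
  moreover have "T s \<noteq> 0" using norm_T[of s] by auto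
  ultimately have "T s \<bullet> u \<noteq> 0" using complex_orthonormal_nonzero uv by blast
  have "(\<gamma> t - \<gamma> s) \<bullet> T s = ((\<gamma> t - \<gamma> s) \<bullet> u) * (u \<bullet> T s) + f ((\<gamma> t - \<gamma> s) \<bullet> u) * (v \<bullet> T s)"
    by (subst rep[OF le]) (simp only: inner_add_left inner_scaleR_left)
  with orth \<open>T s \<bullet> v = 0\<close> \<open>T s \<bullet> u \<noteq> 0\<close> have "(\<gamma> t - \<gamma> s) \<bullet> u = 0" by (simp add: inner_commute)
  then have "\<gamma> t - \<gamma> s = 0" using rep[OF le] f(1) by simp
  with neq show False by simp
qed

section \<open>Comparison of two curves with the same data\<close>

lemma TGL_curves_chord_loop:
  assumes c: "(L, \<gamma>) \<in> TGL_curves r" and "r > 0"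
  obtains T T' where "chord_loop L \<gamma> T T' r"
proof -
  define T where "T s = vector_derivative \<gamma> (at s)" for s
  define T' where "T' s = vector_derivative T (at s)" for s
  have C2: "C2_simple_closed_arclength (L, \<gamma>)" and ccw: "counterclockwise (L, \<gamma>)" and tgl: "TGL (L, \<gamma>) r"
    using c by (auto simp: TGL_curves_def)
  have diff: "\<gamma> differentiable (at s)" "T differentiable (at s)" for s
    using C2 unfolding C2_simple_closed_arclength_def T_def[abs_def] by (auto simp: C1_differentiable_on_eq)
  have per: "\<gamma> (s + L) = \<gamma> s" and unit: "norm (T s) = 1" for s
    using C2 unfolding C2_simple_closed_arclength_def T_def by auto
  have "L > 0" and simple: "simple_path (\<lambda>t. \<gamma> (L * t))"
    using C2 unfolding C2_simple_closed_arclength_def unit_param_def by auto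
  interpret loop L \<gamma> T T'
  proof
    show "(\<gamma> has_vector_derivative T s) (at s)" for s
      using diff(1) unfolding T_def by (rule vector_derivative_works[THEN iffD1])
    show "(T has_vector_derivative T' s) (at s)" for s
      using diff(2) unfolding T'_def by (rule vector_derivative_works[THEN iffD1])
  qed (fact \<open>L > 0\<close> per unit simple)+
  have "chord_loop L \<gamma> T T' r"
  proof
    show "(\<gamma> t - \<gamma> s) \<bullet> T s \<noteq> 0" if "\<gamma> t \<noteq> \<gamma> s" "norm (\<gamma> t - \<gamma> s) \<le> r" for s t
      using tgl gamma_in_boundary TGL_at_imp_not_orthogonal[OF _ \<open>r > 0\<close> that] by (simp add: TGL_def)
  qed (fact ccw \<open>r > 0\<close>)+
  then show thesis by (rule that)
qed

text \<open>Once the curvatures agree this is the uniqueness part of the fundamental theorem of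
  plane curves: the quotient of the two tangents is a constant rotation, and after applying it the
  curves differ by a constant.\<close>

lemma curve_determined:
  assumes "chord_loop L \<gamma> T T' r" "chord_loop L \<eta> U U' r"
    and same: "same_data r (L, \<gamma>) (L, \<eta>)"
  shows "equal_mod_reparam_rigid (L, \<gamma>) (L, \<eta>)"
proof -
  interpret A: chord_loop L \<gamma> T T' r by fact
  interpret B: chord_loop L \<eta> U U' r by fact
  obtain \<tau>1 \<tau>2 where \<tau>: "\<And>s. A.crossing s r (\<tau>1 s) (\<tau>2 s)" using A.ex_crossing_functions by blast
  obtain \<sigma>1 \<sigma>2 where \<sigma>: "\<And>s. B.crossing s r (\<sigma>1 s) (\<sigma>2 s)" using B.ex_crossing_functions by blast
  have eq: "A.direction s (\<tau>1 s) = B.direction s (\<sigma>1 s)" "A.direction s (\<tau>2 s) = B.direction s (\<sigma>2 s)"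
    "A.slope s (\<tau>2 s) - A.slope s (\<tau>1 s) = B.slope s (\<sigma>2 s) - B.slope s (\<sigma>1 s)"
    if s: "s \<in> {0..L}" for s
  proof -
    obtain a where a: "has_partial (area_fun (L, \<gamma>)) [Var_r] s r (r * a)"
      "has_partial (area_fun (L, \<gamma>)) [Var_s] s r (r * Im (A.direction s (\<tau>2 s) - A.direction s (\<tau>1 s)))"
      "has_partial (area_fun (L, \<gamma>)) [Var_r, Var_r] s r (a + (A.slope s (\<tau>2 s) - A.slope s (\<tau>1 s)))"
      "A.direction s (\<tau>2 s) = cis a * A.direction s (\<tau>1 s)"
      "norm (A.direction s (\<tau>1 s)) = 1" "norm (A.direction s (\<tau>2 s)) = 1"
      "Re (A.direction s (\<tau>1 s)) > 0" "Re (A.direction s (\<tau>2 s)) < 0"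
      using A.data_at[OF s \<tau>] by blast
    obtain b where b: "has_partial (area_fun (L, \<eta>)) [Var_r] s r (r * b)"
      "has_partial (area_fun (L, \<eta>)) [Var_s] s r (r * Im (B.direction s (\<sigma>2 s) - B.direction s (\<sigma>1 s)))"
      "has_partial (area_fun (L, \<eta>)) [Var_r, Var_r] s r (b + (B.slope s (\<sigma>2 s) - B.slope s (\<sigma>1 s)))"
      "B.direction s (\<sigma>2 s) = cis b * B.direction s (\<sigma>1 s)"
      "norm (B.direction s (\<sigma>1 s)) = 1" "norm (B.direction s (\<sigma>2 s)) = 1"
      "Re (B.direction s (\<sigma>1 s)) > 0" "Re (B.direction s (\<sigma>2 s)) < 0"
      using B.data_at[OF s \<sigma>] by blast
    have "r * a = r * b"
      by (rule same_data_eq[OF same _ _ a(1) b(1)]) (use s in auto)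
    then have ab: "a = b" using A.r_pos by simp
    have "r * Im (A.direction s (\<tau>2 s) - A.direction s (\<tau>1 s)) = r * Im (B.direction s (\<sigma>2 s) - B.direction s (\<sigma>1 s))"
      by (rule same_data_eq[OF same _ _ a(2) b(2)]) (use s in auto)
    then have im: "Im (A.direction s (\<tau>2 s) - A.direction s (\<tau>1 s)) = Im (B.direction s (\<sigma>2 s) - B.direction s (\<sigma>1 s))"
      using A.r_pos by simp
    have "a + (A.slope s (\<tau>2 s) - A.slope s (\<tau>1 s)) = b + (B.slope s (\<sigma>2 s) - B.slope s (\<sigma>1 s))"
      by (rule same_data_eq[OF same _ _ a(3) b(3)]) (use s in auto)
    then show "A.slope s (\<tau>2 s) - A.slope s (\<tau>1 s) = B.slope s (\<sigma>2 s) - B.slope s (\<sigma>1 s)"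
      using ab by simp
    have re: "Re (A.direction s (\<tau>2 s) - A.direction s (\<tau>1 s)) < 0"
      "Re (B.direction s (\<sigma>2 s) - B.direction s (\<sigma>1 s)) < 0"
      using a(7,8) b(7,8) by auto
    note * = unit_pair_determined[OF a(4) b(4)[folded ab] a(5) b(5) im re]
    show "A.direction s (\<tau>1 s) = B.direction s (\<sigma>1 s)" by (rule *(1))
    show "A.direction s (\<tau>2 s) = B.direction s (\<sigma>2 s)" by (rule *(2))
  qed
  \<comment> \<open>The data cover only the base period, so the directions can be compared on a
    neighbourhood, and hence differentiated, at interior parameters.\<close>
  have curv: "A.curvature s = B.curvature s" if s: "s \<in> {0<..<L}" for s
  proof -
    have "\<forall>\<^sub>F y in nhds s. A.crossing y r (\<tau>1 y) (\<tau>2 y)" using \<tau> by simp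
    note dA = A.crossing_has_real_derivative[OF DERIV_ident DERIV_const[of r] this, simplified]
    have "\<forall>\<^sub>F y in nhds s. B.crossing y r (\<sigma>1 y) (\<sigma>2 y)" using \<sigma> by simp
    note dB = B.crossing_has_real_derivative[OF DERIV_ident DERIV_const[of r] this, simplified]
    have cA: "norm (\<gamma> (\<tau>1 s) - \<gamma> s) = r" "norm (\<gamma> (\<tau>2 s) - \<gamma> s) = r"
      "(\<gamma> (\<tau>1 s) - \<gamma> s) \<bullet> T (\<tau>1 s) \<noteq> 0" "(\<gamma> (\<tau>2 s) - \<gamma> s) \<bullet> T (\<tau>2 s) \<noteq> 0"
      using \<tau>[of s] by (auto simp: A.crossing_def)
    have cB: "norm (\<eta> (\<sigma>1 s) - \<eta> s) = r" "norm (\<eta> (\<sigma>2 s) - \<eta> s) = r"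
      "(\<eta> (\<sigma>1 s) - \<eta> s) \<bullet> U (\<sigma>1 s) \<noteq> 0" "(\<eta> (\<sigma>2 s) - \<eta> s) \<bullet> U (\<sigma>2 s) \<noteq> 0"
      using \<sigma>[of s] by (auto simp: B.crossing_def)
    have uniq: "D = D'"
      if D: "((\<lambda>u. A.direction u (\<tau> u)) has_vector_derivative D) (at s)"
        "((\<lambda>u. B.direction u (\<sigma> u)) has_vector_derivative D') (at s)"
        and e: "\<And>u. u \<in> {0..L} \<Longrightarrow> A.direction u (\<tau> u) = B.direction u (\<sigma> u)" for D D' \<tau> \<sigma>
    proof -
      have "((\<lambda>u. B.direction u (\<sigma> u)) has_vector_derivative D) (at s)"
        using D(1) by (rule has_vector_derivative_transform_within_open[of _ _ _ "{0<..<L}"]) (use s e in auto)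
      then show ?thesis using D(2) vector_derivative_unique_at by blast
    qed
    let ?a = "\<lambda>\<tau>. A.direction s (\<tau> s)"
    obtain D1 where D1: "((\<lambda>u. A.direction u (\<tau>1 u)) has_vector_derivative D1) (at s)"
      "Im (D1 * cnj (?a \<tau>1)) = (A.slope s (\<tau>1 s) * Re (?a \<tau>1) + Im (?a \<tau>1)) / r - A.curvature s"
      using A.direction_derivative[OF dA(1) cA(1,3)] by blast
    obtain D2 where D2: "((\<lambda>u. A.direction u (\<tau>2 u)) has_vector_derivative D2) (at s)"
      "Im (D2 * cnj (?a \<tau>2)) = (A.slope s (\<tau>2 s) * Re (?a \<tau>2) + Im (?a \<tau>2)) / r - A.curvature s"
      using A.direction_derivative[OF dA(2) cA(2,4)] by blast
    let ?b = "\<lambda>\<sigma>. B.direction s (\<sigma> s)"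
    obtain E1 where E1: "((\<lambda>u. B.direction u (\<sigma>1 u)) has_vector_derivative E1) (at s)"
      "Im (E1 * cnj (?b \<sigma>1)) = (B.slope s (\<sigma>1 s) * Re (?b \<sigma>1) + Im (?b \<sigma>1)) / r - B.curvature s"
      using B.direction_derivative[OF dB(1) cB(1,3)] by blast
    obtain E2 where E2: "((\<lambda>u. B.direction u (\<sigma>2 u)) has_vector_derivative E2) (at s)"
      "Im (E2 * cnj (?b \<sigma>2)) = (B.slope s (\<sigma>2 s) * Re (?b \<sigma>2) + Im (?b \<sigma>2)) / r - B.curvature s"
      using B.direction_derivative[OF dB(2) cB(2,4)] by blast
    have s': "s \<in> {0..L}" using s by auto
    have "D1 = E1" by (rule uniq[OF D1(1) E1(1) eq(1)])
    moreover have "D2 = E2" by (rule uniq[OF D2(1) E2(1) eq(2)])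
    ultimately have
      "(A.slope s (\<tau>1 s) * Re (?a \<tau>1) + Im (?a \<tau>1)) / r - A.curvature s =
        (B.slope s (\<sigma>1 s) * Re (?a \<tau>1) + Im (?a \<tau>1)) / r - B.curvature s"
      "(A.slope s (\<tau>2 s) * Re (?a \<tau>2) + Im (?a \<tau>2)) / r - A.curvature s =
        (B.slope s (\<sigma>2 s) * Re (?a \<tau>2) + Im (?a \<tau>2)) / r - B.curvature s"
      using D1(2) E1(2) D2(2) E2(2) eq(1,2)[OF s'] by simp_all
    then have k: "(A.slope s (\<tau>1 s) - B.slope s (\<sigma>1 s)) * Re (?a \<tau>1) = r * (A.curvature s - B.curvature s)"
      "(A.slope s (\<tau>2 s) - B.slope s (\<sigma>2 s)) * Re (?a \<tau>2) = r * (A.curvature s - B.curvature s)"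
      using A.r_pos by (auto simp: field_simps)
    \<comment> \<open>Both slope discrepancies are the same number. Multiplied by the real part of
      either direction it gives r times the discrepancy of the curvatures; as these real parts have
      opposite signs, both discrepancies vanish.\<close>
    have d: "A.slope s (\<tau>2 s) - B.slope s (\<sigma>2 s) = A.slope s (\<tau>1 s) - B.slope s (\<sigma>1 s)"
      using eq(3)[OF s'] by simp
    have "Re (?a \<tau>1) > 0" "Re (?a \<tau>2) < 0"
      using A.data_at[OF s' \<tau>] by blast+
    then have "Re (?a \<tau>1) \<noteq> Re (?a \<tau>2)" by simp
    then have "A.slope s (\<tau>1 s) - B.slope s (\<sigma>1 s) = 0"
      using k unfolding d by (metis mult_cancel_left)
    then show ?thesis using k(1) A.r_pos by simp
  qed
  define a where "a = U 0 * cnj (T 0)"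
  have "U s * cnj (T s) = a" if s: "s \<in> {0..L}" for s
  \<comment> \<open>The ends 0 and L are exceptional because the curvatures were compared only
    between them; continuity suffices there.\<close>
  proof (rule has_derivative_zero_unique_strong_interval[where k="{0, L}" and a=0 and b=L and f="\<lambda>s. U s * cnj (T s)"])
    show "continuous_on {0..L} (\<lambda>s. U s * cnj (T s))"
      by (intro continuous_intros A.continuous_T B.continuous_T)
    fix x assume "x \<in> {0..L} - {0, L}"
    then have "A.curvature x = B.curvature x" using curv by auto
    then have "U x * cnj (T' x) + U' x * cnj (T x) = 0"
      by (simp add: A.T'_eq[of x] B.T'_eq[of x] algebra_simps)
    with has_vector_derivative_mult[OF B.deriv2 bounded_linear.has_vector_derivative[OF bounded_linear_cnj A.deriv2], of x]
    have "((\<lambda>s. U s * cnj (T s)) has_vector_derivative 0) (at x)" by simp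
    then show "((\<lambda>s. U s * cnj (T s)) has_derivative (\<lambda>h. 0)) (at x within {0..L})"
      by (simp add: has_vector_derivative_def has_derivative_at_withinI)
  qed (use s A.L_pos in \<open>auto simp: a_def\<close>)
  then have U: "U s = a * T s" if "s \<in> {0..L}" for s
    using A.T_cnj[of s] that by (metis mult.assoc mult.commute mult.right_neutral)
  have na: "norm a = 1" by (simp add: a_def norm_mult A.norm_T B.norm_T)
  define b where "b = \<eta> 0 - a * \<gamma> 0"
  have base: "\<eta> s - a * \<gamma> s = b" if s: "s \<in> {0..L}" for s
  proof (rule has_derivative_zero_unique_strong_interval[where k="{}" and a=0 and b=L and f="\<lambda>s. \<eta> s - a * \<gamma> s"])
    show "continuous_on {0..L} (\<lambda>s. \<eta> s - a * \<gamma> s)"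
      by (intro continuous_intros A.continuous_gamma B.continuous_gamma)
    fix x assume x: "x \<in> {0..L} - {}"
    have "((\<lambda>s. \<eta> s - a * \<gamma> s) has_vector_derivative U x - a * T x) (at x)"
      by (intro has_vector_derivative_diff B.deriv has_vector_derivative_mult_right A.deriv)
    then show "((\<lambda>s. \<eta> s - a * \<gamma> s) has_derivative (\<lambda>h. 0)) (at x within {0..L})"
      using U x by (simp add: has_vector_derivative_def has_derivative_at_withinI)
  qed (use s in \<open>auto simp: b_def\<close>)
  have "\<eta> s = a * \<gamma> s + b" for s
  proof -
    define k where "k = \<lfloor>s / L\<rfloor>"
    have "s + of_int (- k) * L \<in> {0..L}"
      using floor_divide_lower[OF A.L_pos, of s] floor_divide_upper[OF A.L_pos, of s]
      by (auto simp: k_def algebra_simps)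
    from base[OF this] show ?thesis
      unfolding A.periodic_int B.periodic_int by (simp add: algebra_simps)
  qed
  \<comment> \<open>Both curves are parametrized by arclength and the data are matched at equal s,
    so the reparametrization is the identity.\<close>
  then show ?thesis
    unfolding equal_mod_reparam_rigid_def
    using na by (intro exI[of _ a] exI[of _ b] exI[of _ "\<lambda>s. s"]) (auto simp: homeomorphism_def)
qed

theorem theorem4p7p1:
  fixes r :: real
  assumes "r > 0"
  shows "C1_dense_in {\<gamma> \<in> TGL_curves r. reconstructible r \<gamma>} (TGL_curves r)"
proof -
  have "reconstructible r c" if c: "c \<in> TGL_curves r" for c
    unfolding reconstructible_def
  proof (intro conjI c ballI impI)
    fix c' assume c': "c' \<in> TGL_curves r" and same: "same_data r c c'"
    obtain L \<gamma> where cL: "c = (L, \<gamma>)" by fastforce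
    obtain L' \<eta> where cL': "c' = (L', \<eta>)" by fastforce
    have "L' = L" using same by (simp add: same_data_def cL cL')
    obtain T T' U U' where "chord_loop L \<gamma> T T' r" "chord_loop L \<eta> U U' r"
      using TGL_curves_chord_loop c c' assms unfolding cL cL' \<open>L' = L\<close> by metis
    then show "equal_mod_reparam_rigid c c'"
      using curve_determined same unfolding cL cL' \<open>L' = L\<close> by blast
  qed
  \<comment> \<open>Each curve serves as its own approximation, at distance 0.\<close>
  then show ?thesis
    unfolding C1_dense_in_def C1_close_def by force
qed

end
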